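(* Let $k$ be a non-archimedean local field, $V$ a finite-dimensional $k$-vector space with a non-archimedean norm $\|\cdot\|$, and $f\colon V\to k$ a polynomial function with zero locus $Z(f)=\{x\in V: f(x)=0\}$. Then: (a) if $Z(f)=\emptyset$, there exist constants $C>0$ and $\beta\ge0$ such that $$|f(x)|\ge \frac{C}{\|x\|^{\beta}}\qquad (x\in V,\ \|x\|\ge1);$$ (b) if $Z(f)\ne\emptyset$, there exist constants $C>0$ and $\alpha,\beta\ge 0$ such that $$|f(x)|\ge C\,\frac{\mathrm{dist}(x,Z(f))^{\alpha}}{\|x\|^{\beta}}\qquad (x\in V,\ \|x\|\ge1).$$
   Context: A local field is a locally compact non-discrete topological field (here non-archimedean, of arbitrary characteristic) with its canonical absolute value $|\cdot|$. For $x\in V$ and nonempty $E\subset V$, $\mathrm{dist}(x,E)=\inf_{y\in E}\|x-y\|$. *)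

theory Defs
  imports "HOL-Analysis.Analysis"
begin

class local_field = field + t2_space + topological_ab_group_add + topological_semigroup_mult +
  assumes tendsto_inverse_nonzero: "a \<noteq> 0 \<Longrightarrow> filterlim inverse (nhds (inverse a)) (nhds a)"
    and locally_compact: "\<exists>U K. open U \<and> compact K \<and> x \<in> U \<and> U \<subseteq> K"
    and not_discrete: "\<not> (\<forall>S :: 'a set. open S)"

definition residue_field :: "('k::field \<Rightarrow> real) \<Rightarrow> 'k set set" where
  "residue_field v = {x. v x \<le> 1} // {(x, y). v x \<le> 1 \<and> v y \<le> 1 \<and> v (x - y) < 1}"

text \<open>
  The canonical absolute value of a non-archimedean local field: the ultrametric absolute value
  that induces the topology and is normalised by having value group \<open>q\<^sup>\<int>\<close>, where \<open>q\<close> is the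
  cardinality of the residue field. Equivalently, a uniformiser has absolute value \<open>1 / q\<close>.
\<close>

locale nonarch_local_field =
  fixes v :: "'k::local_field \<Rightarrow> real"
  assumes nonneg: "v x \<ge> 0"
    and eq_0_iff: "v x = 0 \<longleftrightarrow> x = 0"
    and mult: "v (x * y) = v x * v y"
    and ultrametric: "v (x + y) \<le> max (v x) (v y)"
    and induces_topology: "open U \<longleftrightarrow> (\<forall>x\<in>U. \<exists>e>0. \<forall>y. v (y - x) < e \<longrightarrow> y \<in> U)"
    and normalised: "v ` (UNIV - {0}) = range (\<lambda>n::int. real (card (residue_field v)) powi n)"

locale nonarch_norm =
  fixes v :: "'k::field \<Rightarrow> real"
    and scale :: "'k \<Rightarrow> 'v::ab_group_add \<Rightarrow> 'v"
    and nrm :: "'v \<Rightarrow> real"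
  assumes nonneg: "nrm x \<ge> 0"
    and eq_0_iff: "nrm x = 0 \<longleftrightarrow> x = 0"
    and scale: "nrm (scale a x) = v a * nrm x"
    and ultrametric: "nrm (x + y) \<le> max (nrm x) (nrm y)"

text \<open>
  The algebra of functions generated by the constants and the linear forms, that is, the
  polynomial expressions in the coordinates with respect to any basis. The format follows
  \<^const>\<open>real_polynomial_function\<close>.
\<close>

inductive polynomial_function_over ::
    "('k::field \<Rightarrow> 'v::ab_group_add \<Rightarrow> 'v) \<Rightarrow> ('v \<Rightarrow> 'k) \<Rightarrow> bool"
  for scale :: "'k \<Rightarrow> 'v \<Rightarrow> 'v"
  where
    linear: "Vector_Spaces.linear scale (*) l \<Longrightarrow> polynomial_function_over scale l"
  | const: "polynomial_function_over scale (\<lambda>x. c)"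
  | add: "polynomial_function_over scale g \<Longrightarrow> polynomial_function_over scale h \<Longrightarrow>
      polynomial_function_over scale (\<lambda>x. g x + h x)"
  | mult: "polynomial_function_over scale g \<Longrightarrow> polynomial_function_over scale h \<Longrightarrow>
      polynomial_function_over scale (\<lambda>x. g x * h x)"

definition zero_locus :: "('v \<Rightarrow> 'k::zero) \<Rightarrow> 'v set" where
  "zero_locus f = {x. f x = 0}"

definition norm_dist :: "('v::ab_group_add \<Rightarrow> real) \<Rightarrow> 'v \<Rightarrow> 'v set \<Rightarrow> real" where
  "norm_dist nrm x E = (INF y\<in>E. nrm (x - y))"

text \<open>
  Real powers of non-negative reals with \<open>0\<^sup>0 = 1\<close>. With \<^const>\<open>powr\<close> the value would be
  \<open>0 powr 0 = 0\<close>, so that the exponent \<open>0\<close> on the distance to \<open>Z(f)\<close> would say nothing on \<open>Z(f)\<close>.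
\<close>

definition rpow :: "real \<Rightarrow> real \<Rightarrow> real" where
  "rpow t a = (if a = 0 then 1 else t powr a)"

end

theory Submission
  imports Defs
begin

text \<open>
  For \<open>\<parallel>x\<parallel> \<ge> 1\<close> put \<open>\<delta>(x) = min 1 (dist(x, Z(f))) / (2 \<parallel>x\<parallel>)\<close>; everything follows from
  \<open>|f(x)| \<ge> \<delta>(x)\<^sup>m\<close> for some \<open>m\<close>. If no \<open>m\<close> works, there is an ultrafilter on \<open>V\<close> containing all the
  sets \<open>{x. |f(x)| < \<delta>(x)\<^sup>m}\<close>. Functions \<open>V \<rightarrow> k\<close> of at most polynomial growth in \<open>1/\<delta>\<close>, modulo the
  negligible ones (those below every power of \<open>\<delta>\<close> along the ultrafilter), form a field \<open>K \<supseteq> k\<close>, and the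
  coordinates of \<open>x\<close> define a point of \<open>K\<^sup>n\<close> at which \<open>f\<close> vanishes. The extension \<open>K / k\<close> is separable:
  elements of \<open>k\<close> that are linearly independent over \<open>k\<^sup>p\<close> remain so over \<open>K\<^sup>p\<close>, by compactness.
  Hence algebraically dependent coordinates include one that is separably algebraic over the
  others, and by induction on the number of coordinates Hensel's lemma moves \<open>x\<close> by a negligible amount
  to an exact zero of \<open>f\<close>. This contradicts \<open>\<delta>(x) \<le> dist(x, Z(f))\<close>, or \<open>Z(f) = \<emptyset>\<close>.
\<close>

subsection \<open>Ultrafilters\<close>

definition ultrafilter :: "'i filter \<Rightarrow> bool" where
  "ultrafilter U \<longleftrightarrow> U \<noteq> bot \<and> (\<forall>P. eventually P U \<or> eventually (\<lambda>i. \<not> P i) U)"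

lemma ultrafilter_not_eventually:
  "ultrafilter U \<Longrightarrow> \<not> eventually P U \<longleftrightarrow> eventually (\<lambda>i. \<not> P i) U"
  using eventually_conj[of P U "\<lambda>i. \<not> P i"] by (auto simp: ultrafilter_def)

text \<open>Zorn's lemma for the proper filters below \<open>F\<close>. The infimum of a nonempty
  chain stays proper, since what holds eventually for it already holds eventually for some member. A
  minimal proper \<open>U\<close> is an ultrafilter: intersecting it with a set that is not
  eventually avoided gives a proper finer filter, hence \<open>U\<close> again.\<close>

lemma ex_ultrafilter_le:
  fixes F :: "'i filter"
  assumes "F \<noteq> bot"
  obtains U where "ultrafilter U" "U \<le> F"
proof -
  let ?A = "{G. G \<le> F \<and> G \<noteq> bot}"
  \<comment> \<open>The order is reversed because finer filters are smaller: maximal for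
    \<open>?r\<close> means minimal among proper filters.\<close>
  let ?r = "{(G, H). G \<in> ?A \<and> H \<in> ?A \<and> H \<le> G}"
  have po: "Partial_order ?r"
    by (auto simp: partial_order_on_def preorder_on_def refl_on_def trans_def antisym_def Field_def)
  have fld: "Field ?r = ?A"
    by (auto simp: Field_def)
  have "\<exists>u\<in>Field ?r. \<forall>a\<in>C. (a, u) \<in> ?r" if C: "C \<in> Chains ?r" for C
  proof (cases "C = {}")
    case True
    with assms fld show ?thesis by auto
  next
    case False
    have sub: "C \<subseteq> ?A" using C by (auto simp: Chains_def)
    have "\<exists>H\<in>C. H \<le> inf G K" if "G \<in> C" "K \<in> C" for G K
      using C that unfolding Chains_def by (auto simp: le_inf_iff)
    then have ev: "eventually P (Inf C) \<longleftrightarrow> (\<exists>G\<in>C. eventually P G)" for P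
      by (intro eventually_Inf_base False)
    have nb: "Inf C \<noteq> bot"
    proof
      assume "Inf C = bot"
      then obtain G where "G \<in> C" "eventually (\<lambda>_. False) G"
        using ev[of "\<lambda>_. False"] by auto
      with sub show False by (auto simp: eventually_False)
    qed
    obtain G where "G \<in> C" "G \<le> F" using False sub by auto
    then have "Inf C \<le> F" by (rule Inf_lower2)
    with nb sub have "\<forall>G\<in>C. (G, Inf C) \<in> ?r" "Inf C \<in> ?A"
      by (auto intro: Inf_lower)
    then show ?thesis unfolding fld by blast
  qed
  from Zorns_po_lemma[OF po this] obtain U where U: "U \<in> ?A"
      and max: "\<forall>G\<in>?A. (U, G) \<in> ?r \<longrightarrow> G = U"
    unfolding fld by auto
  have min: "G = U" if "G \<noteq> bot" "G \<le> U" for G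
  proof -
    have "G \<in> ?A" using that U by (simp add: order_trans[of G U F])
    moreover from this have "(U, G) \<in> ?r" using that U by simp
    ultimately show ?thesis using max by blast
  qed
  have "eventually P U \<or> eventually (\<lambda>i. \<not> P i) U" for P
  proof (rule disjCI)
    assume *: "\<not> eventually (\<lambda>i. \<not> P i) U"
    have "inf U (principal {i. P i}) \<noteq> bot"
      using * unfolding trivial_limit_def eventually_inf_principal by simp
    then have "inf U (principal {i. P i}) = U"
      by (rule min) simp
    moreover have "eventually P (inf U (principal {i. P i}))"
      unfolding eventually_inf_principal by simp
    ultimately show "eventually P U" by simp
  qed
  with U show ?thesis by (intro that[of U]) (simp_all add: ultrafilter_def)
qed

subsection \<open>Non-archimedean local fields\<close>

context nonarch_local_field
begin

section \<open>Elementary properties of the absolute value\<close>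

lemma v_zero [simp]: "v 0 = 0"
  by (simp add: eq_0_iff)

lemma v_pos: "x \<noteq> 0 \<Longrightarrow> v x > 0"
  using nonneg[of x] eq_0_iff[of x] by linarith

lemma v_one [simp]: "v 1 = 1"
  using mult[of 1 1] eq_0_iff[of 1] by simp

lemma v_power: "v (x ^ n) = v x ^ n"
  by (induction n) (simp_all add: mult)

lemma v_minus [simp]: "v (- x) = v x"
proof -
  have "v (-1) ^ 2 = 1" using v_power[of "-1" 2] by simp
  then have "v (-1) = 1" using nonneg[of "-1"] by (simp add: power2_eq_1_iff)
  then show ?thesis using mult[of "-1" x] by simp
qed

lemma v_minus_commute: "v (x - y) = v (y - x)"
  using v_minus[of "x - y"] by simp

lemma v_diff_le: "v (x - y) \<le> max (v x) (v y)"
  using ultrametric[of x "- y"] by simp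

lemma v_add_le: "v x \<le> c \<Longrightarrow> v y \<le> c \<Longrightarrow> v (x + y) \<le> c"
  using ultrametric[of x y] by (meson max.bounded_iff order_trans)

lemma v_sum_le:
  assumes "\<And>i. i \<in> A \<Longrightarrow> v (f i) \<le> c" "c \<ge> 0"
  shows "v (sum f A) \<le> c"
  using assms by (induction A rule: infinite_finite_induct) (simp_all add: v_add_le)

lemma v_divide: "v (x / y) = v x / v y"
proof (cases "y = 0")
  case False
  then have "v (x / y) * v y = v x" by (simp flip: mult)
  then show ?thesis using v_pos[OF False] by (simp add: field_simps)
qed simp

lemma v_add_eq: "v y < v x \<Longrightarrow> v (x + y) = v x"
  using ultrametric[of x y] v_diff_le[of "x + y" y] by (simp add: max_def split: if_splits)

lemma v_abs_diff_le: "\<bar>v x - v y\<bar> \<le> v (x - y)"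
proof -
  have "v x \<le> max (v (x - y)) (v y)" "v y \<le> max (v (x - y)) (v x)"
    using ultrametric[of "x - y" y] ultrametric[of "y - x" x] v_minus_commute[of x y] by simp_all
  then show ?thesis using nonneg[of "x - y"] nonneg[of x] nonneg[of y] by linarith
qed

lemma continuous_v [continuous_intros]:
  assumes "continuous_on S f"
  shows "continuous_on S (\<lambda>x. v (f x))"
proof -
  have "isCont v x" for x
    unfolding isCont_def
  proof (rule tendstoI)
    fix e :: real assume "e > 0"
    have "open {y. v (y - x) < e}"
      unfolding induces_topology
    proof (intro ballI exI conjI allI impI)
      fix y z assume "y \<in> {y. v (y - x) < e}" "v (z - y) < e"
      then show "z \<in> {y. v (y - x) < e}"
        using ultrametric[of "z - y" "y - x"] by simp
    qed (rule \<open>e > 0\<close>)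
    then have "eventually (\<lambda>y. y \<in> {y. v (y - x) < e}) (nhds x)"
      by (rule eventually_nhds_in_open) (simp add: \<open>e > 0\<close>)
    then have "eventually (\<lambda>y. dist (v y) (v x) < e) (nhds x)"
    proof (rule eventually_mono)
      fix y assume "y \<in> {y. v (y - x) < e}"
      then show "dist (v y) (v x) < e" using v_abs_diff_le[of y x] by (simp add: dist_real_def)
    qed
    then show "eventually (\<lambda>y. dist (v y) (v x) < e) (at x)"
      by (metis eventually_nhds_conv_at)
  qed
  then have "continuous_on UNIV v" by (simp add: continuous_at_imp_continuous_on)
  from continuous_on_compose2[OF this assms] show ?thesis by simp
qed

section \<open>Balls and their compactness\<close>

lemma closed_cball_v: "closed {x. v (x - a) \<le> r}"
  by (intro closed_Collect_le continuous_intros)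

text \<open>Otherwise the open unit ball around each point is that point alone, and the topology is
  discrete.\<close>

lemma ex_small: "\<exists>a. a \<noteq> 0 \<and> v a < 1"
proof (rule ccontr)
  assume "\<nexists>a. a \<noteq> 0 \<and> v a < 1"
  then have *: "v a \<ge> 1" if "a \<noteq> 0" for a
    using that by force
  have "open S" for S :: "'k set"
    unfolding induces_topology
  proof (intro ballI exI[of _ 1] conjI allI impI)
    fix x y assume "x \<in> S" "v (y - x) < 1"
    then show "y \<in> S" using *[of "y - x"] by (cases "y = x") auto
  qed simp
  with not_discrete show False by blast
qed

text \<open>Local compactness gives one compact ball around 0; division by a power of an element of
  absolute value below 1, followed by a translation, carries it to the given ball.\<close>

lemma compact_cball_v: "compact {x. v (x - c) \<le> r}"
proof -
  obtain O' K where OK: "open O'" "compact K" "(0::'k) \<in> O'" "O' \<subseteq> K"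
    using locally_compact by blast
  obtain e where e: "e > 0" "\<And>y. v (y - 0) < e \<Longrightarrow> y \<in> O'"
    using OK(1,3) unfolding induces_topology by blast
  obtain a where a: "a \<noteq> 0" "v a < 1" using ex_small by blast
  have "(\<lambda>n. r * v a ^ n) \<longlonglongrightarrow> r * 0"
    using a nonneg[of a] by (intro tendsto_mult tendsto_const LIMSEQ_power_zero) simp
  then have "eventually (\<lambda>n. r * v a ^ n < e) sequentially"
    using e(1) by (simp add: order_tendstoD(2))
  then obtain n where n: "r * v a ^ n < e" by (auto simp: eventually_sequentially)
  let ?L = "{x. v (x - 0) \<le> r * v a ^ n}"
  have "?L \<subseteq> K" using e(2) n OK(4) by force
  then have "compact ?L"
    using compact_Int_closed[OF OK(2) closed_cball_v[of 0 "r * v a ^ n"]] by (simp add: Int_absorb1)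
  then have "compact ((\<lambda>x. c + x * inverse (a ^ n)) ` ?L)"
    by (intro compact_continuous_image continuous_intros)
  also have "(\<lambda>x. c + x * inverse (a ^ n)) ` ?L = {x. v (x - c) \<le> r}"
  proof (intro equalityI subsetI)
    fix x assume "x \<in> (\<lambda>x. c + x * inverse (a ^ n)) ` ?L"
    then obtain z where z: "x = c + z / a ^ n" "v z \<le> r * v a ^ n" by (auto simp: divide_inverse)
    then show "x \<in> {x. v (x - c) \<le> r}"
      using v_pos[OF a(1)] by (simp add: v_divide v_power field_simps)
  next
    fix x assume "x \<in> {x. v (x - c) \<le> r}"
    then have "(x - c) * a ^ n \<in> ?L"
      using nonneg[of a] by (simp add: mult v_power mult_right_mono)
    moreover have "x = c + (x - c) * a ^ n * inverse (a ^ n)" using a(1) by (simp add: mult.assoc)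
    ultimately show "x \<in> (\<lambda>x. c + x * inverse (a ^ n)) ` ?L" by blast
  qed
  finally show ?thesis .
qed

section \<open>Polynomial estimates and Hensel's lemma\<close>

lemma continuous_poly_v [continuous_intros]:
  assumes "continuous_on S f"
  shows "continuous_on S (\<lambda>x. poly p (f x :: 'k))"
  by (induction p) (auto intro!: continuous_intros assms)

lemma v_of_nat_le_one: "v (of_nat n) \<le> 1"
  by (induction n) (simp_all add: v_add_le)

text \<open>Here \<open>n\<close> bounds the number of coefficients, not the degree: the term of
  index \<open>i < n\<close> is a product of \<open>i + 1\<close> factors of size at most
  \<open>B\<close>.\<close>

lemma v_poly_le:
  assumes "\<And>i. v (coeff p i) \<le> B" "\<And>i. i \<ge> n \<Longrightarrow> coeff p i = 0" "v y \<le> B" "B \<ge> 1"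
  shows "v (poly p y) \<le> B ^ n"
  unfolding poly_altdef
proof (rule v_sum_le)
  fix i
  show "v (coeff p i * y ^ i) \<le> B ^ n"
  proof (cases "i < n")
    case True
    have "v (coeff p i) * v y ^ i \<le> B * B ^ i"
      using assms by (intro mult_mono power_mono) (auto simp: nonneg)
    also have "\<dots> = B ^ Suc i" by simp
    also have "\<dots> \<le> B ^ n" using True assms(4) by (intro power_increasing) auto
    finally show ?thesis by (simp add: mult v_power)
  qed (use assms(2,4) in auto)
qed (use assms(4) in auto)

lemma v_coeff_pderiv_le:
  assumes "\<And>i. v (coeff p i) \<le> B"
  shows "v (coeff (pderiv p) i) \<le> B"
proof -
  have "v (of_nat (Suc i)) * v (coeff p (Suc i)) \<le> 1 * B"
    using assms[of "Suc i"] v_of_nat_le_one[of "Suc i"] by (intro mult_mono) (auto simp: nonneg)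
  then show ?thesis by (simp add: coeff_pderiv mult del: of_nat_Suc)
qed

text \<open>Horner induction: if \<open>p = a + X q\<close>, the remainder of \<open>p\<close> is
  \<open>(y + h)\<close> times that of \<open>q\<close>, plus \<open>h ^ 2\<close> times the
  derivative of \<open>q\<close> at \<open>y\<close>. No second derivative is divided by 2, so the
  bound holds in every characteristic.\<close>

lemma v_taylor_le:
  assumes "\<And>i. v (coeff p i) \<le> B" "\<And>i. i \<ge> n \<Longrightarrow> coeff p i = 0"
    and y: "v y \<le> B" and h: "v h \<le> B" and B: "B \<ge> 1"
  shows "v (poly p (y + h) - poly p y - h * poly (pderiv p) y) \<le> B ^ n * v h ^ 2"
  using assms(1,2)
proof (induction n arbitrary: p)
  case 0
  then have "p = 0" by (intro poly_eqI) simp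
  then show ?case by simp
next
  case (Suc n)
  obtain a q where p: "p = pCons a q" by (cases p)
  have q: "\<And>i. v (coeff q i) \<le> B" "\<And>i. i \<ge> n \<Longrightarrow> coeff q i = 0"
    using Suc.prems(1)[of "Suc _"] Suc.prems(2)[of "Suc _"] by (simp_all add: p)
  define e where "e = poly q (y + h) - poly q y - h * poly (pderiv q) y"
  have e: "v e \<le> B ^ n * v h ^ 2" unfolding e_def by (rule Suc.IH[OF q])
  have "v (y + h) * v e \<le> B * (B ^ n * v h ^ 2)"
    using e y h B by (intro mult_mono v_add_le) (auto simp: nonneg)
  moreover have "v h ^ 2 * v (poly (pderiv q) y) \<le> v h ^ 2 * B ^ Suc n"
  proof (rule mult_left_mono)
    have "v (poly (pderiv q) y) \<le> B ^ n"
      using q B y by (intro v_poly_le v_coeff_pderiv_le) (simp_all add: coeff_pderiv)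
    also have "\<dots> \<le> B ^ Suc n" using B by (intro power_increasing) auto
    finally show "v (poly (pderiv q) y) \<le> B ^ Suc n" .
  qed simp
  ultimately have "v ((y + h) * e + h ^ 2 * poly (pderiv q) y) \<le> B ^ Suc n * v h ^ 2"
    by (intro v_add_le) (simp_all add: mult v_power mult_ac)
  also have "(y + h) * e + h ^ 2 * poly (pderiv q) y
      = poly p (y + h) - poly p y - h * poly (pderiv p) y"
    by (simp add: p e_def pderiv_pCons algebra_simps power2_eq_square)
  finally show ?case .
qed

text \<open>Compactness replaces the usual iteration: one Newton step from a minimum of \<open>v (poly p _)\<close>
  on the ball of radius \<open>v (poly p y) / v (poly (pderiv p) y)\<close> would decrease it further.\<close>

lemma hensel:
  assumes p: "\<And>i. v (coeff p i) \<le> B" "\<And>i. i \<ge> n \<Longrightarrow> coeff p i = 0"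
    and y: "v y \<le> B" and B: "B \<ge> 1"
    and D: "poly (pderiv p) y \<noteq> 0" "v (poly p y) \<le> v (poly (pderiv p) y)"
    and small: "B ^ n * v (poly p y) < v (poly (pderiv p) y) ^ 2"
  obtains z where "poly p z = 0" "v (z - y) \<le> v (poly p y) / v (poly (pderiv p) y)"
proof -
  define D where "D = v (poly (pderiv p) y)"
  define r where "r = v (poly p y) / D"
  have D0: "D > 0" using assms(5) by (simp add: D_def v_pos)
  have r: "r \<ge> 0" "r \<le> 1" using D0 assms(6) by (simp_all add: r_def D_def nonneg)
  have Br: "B ^ n * r < D"
    using small D0 by (simp add: r_def D_def field_simps power2_eq_square)
  let ?K = "{z. v (z - y) \<le> r}"
  have "compact ?K" "y \<in> ?K" using r by (simp_all add: compact_cball_v)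
  moreover have "continuous_on ?K (\<lambda>z. v (poly p z))"
    by (intro continuous_v continuous_poly_v continuous_on_id)
  ultimately have "\<exists>z\<in>?K. \<forall>w\<in>?K. v (poly p z) \<le> v (poly p w)"
    by (intro continuous_attains_inf) blast+
  then obtain z where z: "z \<in> ?K" and min: "\<And>w. w \<in> ?K \<Longrightarrow> v (poly p z) \<le> v (poly p w)"
    by blast
  have zy: "v (z - y) \<le> 1" "v (z - y) \<le> B" using z r B by auto
  have zB: "v z \<le> B" using v_add_le[of "z - y" B y] zy y by simp
  \<comment> \<open>Between \<open>y\<close> and \<open>z\<close> the derivative changes by at most
    \<open>B ^ n * r\<close>, which is below \<open>D\<close>; by the ultrametric inequality its
    absolute value at \<open>z\<close> is still \<open>D\<close>.\<close>
  have "v (poly (pderiv p) z - poly (pderiv p) y) < D"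
  proof -
    define q where "q = pderiv p"
    have q: "\<And>i. v (coeff q i) \<le> B" "\<And>i. i \<ge> n \<Longrightarrow> coeff q i = 0"
      using p by (simp_all add: q_def v_coeff_pderiv_le) (simp add: coeff_pderiv)
    have "v (poly (pderiv q) y) \<le> B ^ n"
      using q y B by (intro v_poly_le v_coeff_pderiv_le) (simp_all add: coeff_pderiv)
    then have "v ((z - y) * poly (pderiv q) y) \<le> B ^ n * v (z - y)"
      using mult_left_mono[OF _ nonneg[of "z - y"]] by (simp add: mult mult.commute[of "B ^ n"])
    moreover have "v (poly q z - poly q y - (z - y) * poly (pderiv q) y) \<le> B ^ n * v (z - y)"
    proof -
      have "v (poly q z - poly q y - (z - y) * poly (pderiv q) y) \<le> B ^ n * v (z - y) ^ 2"
        using v_taylor_le[of q B n y "z - y"] q y B zy by simp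
      also have "\<dots> \<le> B ^ n * v (z - y)"
        using zy nonneg[of "z - y"] B
        by (intro mult_left_mono) (auto simp: power2_eq_square mult_left_le)
      finally show ?thesis .
    qed
    ultimately have "v (poly q z - poly q y) \<le> B ^ n * v (z - y)"
      using v_add_le[of "poly q z - poly q y - (z - y) * poly (pderiv q) y"] by fastforce
    also have "\<dots> \<le> B ^ n * r" using z B by (intro mult_left_mono) auto
    finally show ?thesis using Br by (simp add: q_def)
  qed
  then have Dz: "v (poly (pderiv p) z) = D"
    using v_add_eq[of "poly (pderiv p) z - poly (pderiv p) y" "poly (pderiv p) y"]
    by (simp add: D_def)
  have "poly p z = 0"
  proof (rule ccontr)
    assume nz: "poly p z \<noteq> 0"
    \<comment> \<open>The Newton increment at the minimum. It cancels the linear part of the Taylor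
      formula, and the quadratic remainder is smaller than \<open>v (poly p z)\<close> because
      \<open>B ^ n * r < D\<close>.\<close>
    define h where "h = - poly p z / poly (pderiv p) z"
    have vh: "v h = v (poly p z) / D"
      by (simp add: h_def v_divide Dz)
    have le: "v (poly p z) \<le> v (poly p y)" using min \<open>y \<in> ?K\<close> by blast
    then have "v h \<le> r" using D0 by (simp add: vh r_def divide_right_mono)
    have "z + h \<in> ?K"
      using v_add_le[of "z - y" r h] z \<open>v h \<le> r\<close> by (simp add: algebra_simps)
    then have "v (poly p z) \<le> v (poly p (z + h))" by (rule min)
    also have "poly (pderiv p) z \<noteq> 0" using Dz D0 by auto
    then have "v (poly p (z + h)) = v (poly p (z + h) - poly p z - h * poly (pderiv p) z)"
      by (simp add: h_def)
    also have "\<dots> \<le> B ^ n * v h ^ 2"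
      using \<open>v h \<le> r\<close> r B by (intro v_taylor_le p zB) auto
    also have "\<dots> = (B ^ n * (v (poly p z) / D)) * (v (poly p z) / D)"
      by (simp add: vh power2_eq_square)
    also have "\<dots> \<le> (B ^ n * r) * (v (poly p z) / D)"
      using le D0 B r
      by (intro mult_right_mono mult_left_mono) (auto simp: r_def divide_right_mono nonneg)
    also have "\<dots> < D * (v (poly p z) / D)"
      using v_pos[OF nz] D0 Br by (intro mult_strict_right_mono) auto
    also have "\<dots> = v (poly p z)" using D0 by simp
    finally show False by simp
  qed
  then show ?thesis using z by (intro that[of z]) (simp_all add: r_def D_def)
qed

text \<open>Dividing \<open>z\<close> by its largest coordinate \<open>z m\<close> lands in the
  compact set \<open>S m\<close>, where \<open>\<phi>\<close> has a positive minimum; homogeneity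
  scales the bound back. Needed in degree 1 for the norm and in degree p for sums of p-th powers
  with independent coefficients.\<close>

lemma homogeneous_lower_bound:
  fixes \<phi> :: "('b \<Rightarrow> 'k) \<Rightarrow> real"
  assumes "finite B" "n > 0" and cont: "continuous_on UNIV \<phi>"
    and nonneg_\<phi>: "\<And>z. \<phi> z \<ge> 0"
    and hom: "\<And>a z. \<phi> (\<lambda>b. a * z b) = v a ^ n * \<phi> z"
    and zero: "\<And>z b. \<phi> z = 0 \<Longrightarrow> b \<in> B \<Longrightarrow> z b = 0"
    and dep: "\<And>z. \<phi> (\<lambda>b. if b \<in> B then z b else 0) = \<phi> z"
  shows "\<exists>C>0. \<forall>z. \<forall>b\<in>B. C * v (z b) ^ n \<le> \<phi> z"
proof -
  \<comment> \<open>Coordinates outside \<open>B\<close> are frozen to 0, which is harmless by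
    \<open>dep\<close> and makes the full product compact.\<close>
  define S where "S b = PiE UNIV (\<lambda>c. if c = b then {1} else if c \<in> B then {x::'k. v (x - 0) \<le> 1} else {0})" for b
  have "\<exists>c>0. \<forall>z\<in>S b. c \<le> \<phi> z" if "b \<in> B" for b
  proof -
    have "compactin (product_topology (\<lambda>_. euclidean) UNIV) (S b)"
      unfolding S_def compactin_PiE using compact_cball_v[of 0 1] by auto
    then have "compact (S b)" by (simp add: euclidean_product_topology)
    moreover have "(\<lambda>c. if c = b then 1 else 0) \<in> S b" by (auto simp: S_def)
    ultimately obtain z where z: "z \<in> S b" "\<forall>w\<in>S b. \<phi> z \<le> \<phi> w"
      using continuous_attains_inf[of "S b" \<phi>] continuous_on_subset[OF cont] by blast
    have "z b = 1" using z(1) by (auto simp: S_def PiE_def Pi_def split: if_splits)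
    then have "\<phi> z \<noteq> 0" using zero[of z b] that by auto
    then have "\<phi> z > 0" using nonneg_\<phi>[of z] by linarith
    with z(2) show ?thesis by blast
  qed
  then obtain c where c: "\<And>b. b \<in> B \<Longrightarrow> c b > 0" "\<And>b z. b \<in> B \<Longrightarrow> z \<in> S b \<Longrightarrow> c b \<le> \<phi> z"
    by metis
  define C where "C = Min (insert 1 (c ` B))"
  have C: "C > 0" "\<And>b. b \<in> B \<Longrightarrow> C \<le> c b"
    using c(1) \<open>finite B\<close> by (auto simp: C_def)
  have "C * v (z b) ^ n \<le> \<phi> z" if b: "b \<in> B" for z b
  proof -
    have "\<exists>m\<in>B. \<forall>c\<in>B. v (z c) \<le> v (z m)"
    proof -
      have "Max ((\<lambda>c. v (z c)) ` B) \<in> (\<lambda>c. v (z c)) ` B" using \<open>finite B\<close> b by (intro Max_in) auto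
      then obtain m where "m \<in> B" "Max ((\<lambda>c. v (z c)) ` B) = v (z m)" by auto
      then show ?thesis using \<open>finite B\<close> by (intro bexI[of _ m]) (metis Max_ge finite_imageI imageI)
    qed
    then obtain m where m: "m \<in> B" "\<And>c. c \<in> B \<Longrightarrow> v (z c) \<le> v (z m)" by blast
    have "C * v (z b) ^ n \<le> C * v (z m) ^ n"
      using m b C(1) by (intro mult_left_mono power_mono) (auto simp: nonneg)
    also have "\<dots> \<le> \<phi> z"
    proof (cases "z m = 0")
      case True
      then show ?thesis using True \<open>n > 0\<close> nonneg_\<phi>[of z] by (simp add: power_0_left)
    next
      case False
      define w where "w = (\<lambda>c. if c \<in> B then z c / z m else 0)"
      have "w \<in> S m"
        using m False v_pos[OF False] by (auto simp: S_def w_def v_divide)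
      then have "C \<le> \<phi> w" using c(2)[OF m(1)] C(2)[OF m(1)] by force
      have "\<phi> w = \<phi> (\<lambda>c. z c / z m)" unfolding w_def by (rule dep)
      then have "v (z m) ^ n * \<phi> w = \<phi> z"
        using hom[of "z m" "\<lambda>c. z c / z m"] False by simp
      then show ?thesis using \<open>C \<le> \<phi> w\<close> nonneg[of "z m"]
        by (metis mult.commute mult_left_mono zero_le_power)
    qed
    finally show ?thesis .
  qed
  with C(1) show ?thesis by blast
qed

end

subsection \<open>Polynomials in coordinates\<close>

inductive coord_poly :: "'j set \<Rightarrow> (('j \<Rightarrow> 'k) \<Rightarrow> 'k::comm_ring_1) \<Rightarrow> bool" for J where
  const: "coord_poly J (\<lambda>z. c)"
| var: "j \<in> J \<Longrightarrow> coord_poly J (\<lambda>z. z j)"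
| add: "coord_poly J f \<Longrightarrow> coord_poly J g \<Longrightarrow> coord_poly J (\<lambda>z. f z + g z)"
| mult: "coord_poly J f \<Longrightarrow> coord_poly J g \<Longrightarrow> coord_poly J (\<lambda>z. f z * g z)"

lemma coord_poly_sum:
  "(\<And>i. i \<in> A \<Longrightarrow> coord_poly J (f i)) \<Longrightarrow> coord_poly J (\<lambda>z. \<Sum>i\<in>A. f i z)"
  by (induction A rule: infinite_finite_induct) (simp_all add: coord_poly.intros)

lemma coord_poly_prod:
  "(\<And>i. i \<in> A \<Longrightarrow> coord_poly J (f i)) \<Longrightarrow> coord_poly J (\<lambda>z. \<Prod>i\<in>A. f i z)"
  by (induction A rule: infinite_finite_induct) (simp_all add: coord_poly.intros)

lemma coord_poly_power: "coord_poly J f \<Longrightarrow> coord_poly J (\<lambda>z. f z ^ n)"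
  by (induction n) (simp_all add: coord_poly.intros)

lemma coord_poly_diff:
  assumes "coord_poly J f" "coord_poly J g"
  shows "coord_poly J (\<lambda>z. f z - g z)"
  using coord_poly.add[OF assms(1) coord_poly.mult[OF coord_poly.const[of J "-1"] assms(2)]] by simp

lemma coord_poly_cong:
  assumes "coord_poly J f" "\<And>j. j \<in> J \<Longrightarrow> z j = w j"
  shows "f z = f w"
  using assms by induction auto

text \<open>Zero outside \<open>J\<close>, so that an exponent vector is determined by its entries
  on \<open>J\<close>; the injectivity of operations on exponents depends on this.\<close>

definition exponents :: "'j set \<Rightarrow> ('j \<Rightarrow> nat) set" where
  "exponents J = {e. \<forall>j. j \<notin> J \<longrightarrow> e j = 0}"

definition mon :: "'j set \<Rightarrow> ('j \<Rightarrow> nat) \<Rightarrow> ('j \<Rightarrow> 'k::comm_ring_1) \<Rightarrow> 'k" where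
  "mon J e z = (\<Prod>j\<in>J. z j ^ e j)"

lemma mon_zero [simp]: "mon J (\<lambda>_. 0) z = 1"
  by (simp add: mon_def)

lemma mon_add: "mon J (\<lambda>j. d j + e j) z = mon J d z * mon J e z"
  by (simp add: mon_def power_add prod.distrib)

lemma mon_remove:
  assumes "finite J" "j \<in> J"
  shows "mon J e z = z j ^ e j * mon (J - {j}) e z"
  unfolding mon_def by (rule prod.remove[OF assms])

lemma coord_poly_mon: "coord_poly J (mon J e)"
  unfolding mon_def by (intro coord_poly_prod coord_poly_power coord_poly.var)

text \<open>Terms with equal exponents are merged; \<open>g\<close> may repeat values, as happens
  when two expansions are added or multiplied.\<close>

lemma mon_sum_collect:
  fixes k :: "'a \<Rightarrow> 'k::comm_ring_1"
  assumes "finite A" "\<And>a. a \<in> A \<Longrightarrow> g a \<in> exponents J"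
  shows "\<exists>E c. finite E \<and> E \<subseteq> exponents J \<and>
    (\<forall>z. (\<Sum>a\<in>A. k a * mon J (g a) z) = (\<Sum>e\<in>E. c e * mon J e z))"
proof (intro exI conjI allI)
  fix z
  show "(\<Sum>a\<in>A. k a * mon J (g a) z) = (\<Sum>e\<in>g ` A. (\<Sum>a | a \<in> A \<and> g a = e. k a) * mon J e z)"
    by (subst sum.image_gen[OF assms(1), of _ g]) (auto simp: sum_distrib_right intro!: sum.cong)
qed (use assms in auto)

lemma coord_poly_expand:
  fixes f :: "('j \<Rightarrow> 'k::comm_ring_1) \<Rightarrow> 'k"
  assumes "coord_poly J f" "finite J"
  shows "\<exists>E c. finite E \<and> E \<subseteq> exponents J \<and> (\<forall>z. f z = (\<Sum>e\<in>E. c e * mon J e z))"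
  using assms(1)
proof induction
  case (const c)
  show ?case
    by (rule exI[of _ "{\<lambda>_. 0}"], rule exI[of _ "\<lambda>_. c"]) (auto simp: exponents_def)
next
  case (var j)
  have "mon J (\<lambda>i. if i = j then 1 else 0) z = (\<Prod>i\<in>J. if i = j then z i else 1)" for z :: "'j \<Rightarrow> 'k"
    unfolding mon_def by (intro prod.cong) auto
  then have "mon J (\<lambda>i. if i = j then 1 else 0) z = z j" for z :: "'j \<Rightarrow> 'k"
    using var assms(2) by (simp add: prod.delta)
  with var show ?case
    by (intro exI[of _ "{\<lambda>i. if i = j then 1 else 0}"] exI[of _ "\<lambda>_. 1"]) (auto simp: exponents_def)
next
  case (add f g)
  then obtain E c E' c' where
    E: "finite E" "E \<subseteq> exponents J" "\<And>z. f z = (\<Sum>e\<in>E. c e * mon J e z)" and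
    E': "finite E'" "E' \<subseteq> exponents J" "\<And>z. g z = (\<Sum>e\<in>E'. c' e * mon J e z)" by blast
  have "f z + g z = (\<Sum>a\<in>E <+> E'. case_sum c c' a * mon J (case_sum id id a) z)" for z
    using E E' by (simp add: sum.Plus)
  moreover have "\<exists>F d. finite F \<and> F \<subseteq> exponents J \<and> (\<forall>z.
      (\<Sum>a\<in>E <+> E'. case_sum c c' a * mon J (case_sum id id a) z) = (\<Sum>e\<in>F. d e * mon J e z))"
    using E E' by (intro mon_sum_collect) auto
  ultimately show ?case by simp
next
  case (mult f g)
  then obtain E c E' c' where
    E: "finite E" "E \<subseteq> exponents J" "\<And>z. f z = (\<Sum>e\<in>E. c e * mon J e z)" and
    E': "finite E'" "E' \<subseteq> exponents J" "\<And>z. g z = (\<Sum>e\<in>E'. c' e * mon J e z)" by blast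
  have "f z * g z = (\<Sum>a\<in>E \<times> E'. (c (fst a) * c' (snd a)) * mon J (\<lambda>j. fst a j + snd a j) z)" for z
    unfolding E(3) E'(3) sum_product
    by (simp add: sum.cartesian_product mon_add case_prod_beta mult_ac)
  moreover have "\<exists>F d. finite F \<and> F \<subseteq> exponents J \<and> (\<forall>z.
      (\<Sum>a\<in>E \<times> E'. (c (fst a) * c' (snd a)) * mon J (\<lambda>j. fst a j + snd a j) z) = (\<Sum>e\<in>F. d e * mon J e z))"
    using E E' by (intro mon_sum_collect) (auto simp: exponents_def)
  ultimately show ?case by simp
qed

text \<open>A polynomial in one further variable over the polynomials in \<open>J\<close>, of degree
  below \<open>n\<close> uniformly in \<open>z\<close>.\<close>

definition poly_family :: "'j set \<Rightarrow> nat \<Rightarrow> (('j \<Rightarrow> 'k) \<Rightarrow> 'k::comm_ring_1 poly) \<Rightarrow> bool" where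
  "poly_family J n F \<longleftrightarrow> (\<forall>i. coord_poly J (\<lambda>z. coeff (F z) i)) \<and> (\<forall>z. \<forall>i\<ge>n. coeff (F z) i = 0)"

lemma poly_family_mono: "poly_family J m F \<Longrightarrow> m \<le> n \<Longrightarrow> poly_family J n F"
  by (simp add: poly_family_def)

lemma poly_family_add:
  "poly_family J n F \<Longrightarrow> poly_family J n G \<Longrightarrow> poly_family J n (\<lambda>z. F z + G z)"
  by (simp add: poly_family_def coord_poly.add)

lemma poly_family_smult:
  "coord_poly J a \<Longrightarrow> poly_family J n F \<Longrightarrow> poly_family J n (\<lambda>z. smult (a z) (F z))"
  by (simp add: poly_family_def coord_poly.mult)

lemma poly_family_monom:
  "coord_poly J a \<Longrightarrow> poly_family J (Suc k) (\<lambda>z. monom (a z) k)"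
  unfolding poly_family_def coeff_monom
proof (intro conjI allI impI)
  fix i assume "coord_poly J a"
  then show "coord_poly J (\<lambda>z. if k = i then a z else 0)"
    by (cases "k = i") (simp_all add: coord_poly.const)
qed simp

lemma poly_family_mult:
  assumes "poly_family J m F" "poly_family J n G"
  shows "poly_family J (m + n) (\<lambda>z. F z * G z)"
  unfolding poly_family_def
proof (intro conjI allI impI)
  fix i
  show "coord_poly J (\<lambda>z. coeff (F z * G z) i)"
    using assms unfolding coeff_mult
    by (intro coord_poly_sum coord_poly.mult) (simp_all add: poly_family_def)
next
  fix z i assume "m + n \<le> i"
  then have "coeff (F z) k * coeff (G z) (i - k) = 0" for k
    using assms by (cases "m \<le> k") (simp_all add: poly_family_def)
  then show "coeff (F z * G z) i = 0" by (simp add: coeff_mult)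
qed

lemma coord_poly_insert:
  assumes "coord_poly (insert j J) f"
  shows "\<exists>n F. poly_family J n F \<and> (\<forall>z. f z = poly (F z) (z j))"
  using assms
proof induction
  case (const c)
  show ?case using poly_family_monom[OF coord_poly.const[of J c], of 0]
    by (intro exI conjI) (auto simp: monom_0)
next
  case (var i)
  show ?case
  proof (cases "i = j")
    case True
    with poly_family_monom[OF coord_poly.const[of J 1], of 1] show ?thesis
      by (intro exI conjI) (auto simp: poly_monom)
  next
    case False
    with var have "coord_poly J (\<lambda>z. z i)" by (intro coord_poly.var) auto
    from poly_family_monom[OF this, of 0] show ?thesis
      by (intro exI conjI) (auto simp: monom_0)
  qed
next
  case (add f g)
  then obtain m F n G where *: "poly_family J m F" "\<And>z. f z = poly (F z) (z j)"
    "poly_family J n G" "\<And>z. g z = poly (G z) (z j)" by blast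
  have "poly_family J (max m n) (\<lambda>z. F z + G z)"
    using poly_family_mono[OF *(1)] poly_family_mono[OF *(3)] by (intro poly_family_add) simp_all
  with * show ?case
    by (intro exI[of _ "max m n"] exI[of _ "\<lambda>z. F z + G z"]) simp
next
  case (mult f g)
  then obtain m F n G where *: "poly_family J m F" "\<And>z. f z = poly (F z) (z j)"
    "poly_family J n G" "\<And>z. g z = poly (G z) (z j)" by blast
  from poly_family_mult[OF *(1,3)] * show ?case
    by (intro exI[of _ "m + n"] exI[of _ "\<lambda>z. F z * G z"]) simp
qed

text \<open>Division with remainder without inverting the formal leading coefficient of
  \<open>G\<close>: each step multiplies by it instead. The identity therefore holds at every
  \<open>z\<close>, even where that coefficient vanishes.\<close>

lemma pseudo_division_family:
  assumes G: "poly_family J (Suc d) G" and F: "poly_family J n F"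
  shows "\<exists>e m Q R. poly_family J m Q \<and> poly_family J d R \<and>
    (\<forall>z. smult (coeff (G z) d ^ e) (F z) = Q z * G z + R z)"
  using F
proof (induction n arbitrary: F)
  case 0
  then have "poly_family J d F" by (rule poly_family_mono) simp
  moreover have "poly_family J 0 (\<lambda>z. 0)" by (simp add: poly_family_def coord_poly.const)
  ultimately show ?case
      by - (rule exI[of _ 0], rule exI[of _ 0], rule exI[of _ "\<lambda>z. 0"], rule exI[of _ F], simp)
next
  case (Suc n)
  show ?case
  proof (cases "n < d")
    case True
    then have "poly_family J d F" using poly_family_mono[OF Suc.prems] by simp
    moreover have "poly_family J 0 (\<lambda>z. 0)" by (simp add: poly_family_def coord_poly.const)
    ultimately show ?thesis
      by - (rule exI[of _ 0], rule exI[of _ 0], rule exI[of _ "\<lambda>z. 0"], rule exI[of _ F], simp)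
  next
    case False
    define g where "g z = coeff (G z) d" for z
    define M where "M z = monom (coeff (F z) n) (n - d)" for z
    \<comment> \<open>The coefficient at \<open>n\<close> cancels, so \<open>F1\<close> has one
      coefficient fewer.\<close>
    define F1 where "F1 z = smult (g z) (F z) - M z * G z" for z
    have g: "coord_poly J g" using G by (simp add: g_def[abs_def] poly_family_def)
    have M: "poly_family J (Suc (n - d)) M"
      unfolding M_def[abs_def] using Suc.prems by (intro poly_family_monom) (simp add: poly_family_def)
    have "coord_poly J (\<lambda>z. coeff (F1 z) i)" for i
      unfolding F1_def coeff_diff
      using poly_family_smult[OF g Suc.prems] poly_family_mult[OF M G]
      by (intro coord_poly_diff) (simp_all add: poly_family_def)
    moreover have "coeff (F1 z) i = 0" if "i \<ge> n" for i z
    proof (cases "i = n")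
      case True
      with False show ?thesis by (simp add: F1_def M_def g_def coeff_monom_mult)
    next
      case i: False
      with that False have "i \<ge> Suc n" "i - (n - d) \<ge> Suc d" by auto
      with Suc.prems G have "coeff (F z) i = 0" "coeff (G z) (i - (n - d)) = 0"
        unfolding poly_family_def by blast+
      then show ?thesis by (simp add: F1_def M_def coeff_monom_mult)
    qed
    ultimately have "poly_family J n F1" by (simp add: poly_family_def)
    from Suc.IH[OF this] obtain e m Q R where
      *: "poly_family J m Q" "poly_family J d R" "\<And>z. smult (g z ^ e) (F1 z) = Q z * G z + R z"
      unfolding g_def by blast
    have "poly_family J (max m (Suc (n - d))) (\<lambda>z. Q z + smult (g z ^ e) (M z))"
      using poly_family_mono[OF *(1)] poly_family_mono[OF M]
      by (intro poly_family_add poly_family_smult coord_poly_power g) simp_all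
    moreover have "smult (g z ^ Suc e) (F z) = (Q z + smult (g z ^ e) (M z)) * G z + R z" for z
    proof -
      have "smult (g z ^ Suc e) (F z) = smult (g z ^ e) (F1 z) + smult (g z ^ e) (M z) * G z"
        by (simp add: F1_def smult_diff_right mult.commute)
      then show ?thesis unfolding *(3) by (simp add: algebra_simps)
    qed
    ultimately show ?thesis using *(2) unfolding g_def
      by - (rule exI[of _ "Suc e"], rule exI[of _ "max m (Suc (n - d))"],
          rule exI[of _ "\<lambda>z. Q z + smult (coeff (G z) d ^ e) (M z)"], rule exI[of _ R], blast)
  qed
qed

subsection \<open>Negligible and bounded functions along an ultrafilter\<close>

lemma poly_eq_sum_lessThan:
  fixes p :: "'a::comm_semiring_1 poly"
  assumes "\<And>i. i \<ge> n \<Longrightarrow> coeff p i = 0"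
  shows "poly p y = (\<Sum>i<n. coeff p i * y ^ i)"
proof -
  have "(\<Sum>i<n. coeff p i * y ^ i) = (\<Sum>i<max n (Suc (degree p)). coeff p i * y ^ i)"
    using assms by (intro sum.mono_neutral_left) auto
  also have "\<dots> = (\<Sum>i\<le>degree p. coeff p i * y ^ i)"
    by (intro sum.mono_neutral_right) (auto simp: coeff_eq_0)
  finally show ?thesis by (simp add: poly_altdef)
qed

lemma poly_family_pderiv:
  fixes F :: "('j \<Rightarrow> 'k) \<Rightarrow> 'k::idom poly"
  assumes "poly_family J n F"
  shows "poly_family J n (\<lambda>z. pderiv (F z))"
  using assms by (auto simp: poly_family_def coeff_pderiv intro!: coord_poly.mult coord_poly.const)

lemma poly_family_sum:
  assumes "\<And>a. a \<in> A \<Longrightarrow> poly_family J n (F a)"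
  shows "poly_family J n (\<lambda>z. \<Sum>a\<in>A. F a z)"
  using assms
proof (induction A rule: infinite_finite_induct)
  case (insert a A)
  then show ?case by (simp add: poly_family_add)
qed (simp_all add: poly_family_def coord_poly.const)

lemma poly_family_cong:
  assumes "poly_family J n F" "\<And>j. j \<in> J \<Longrightarrow> z j = w j"
  shows "F z = F w"
proof (rule poly_eqI)
  fix i
  have "coord_poly J (\<lambda>z. coeff (F z) i)" using assms(1) by (simp add: poly_family_def)
  from coord_poly_cong[OF this assms(2)] show "coeff (F z) i = coeff (F w) i" .
qed

text \<open>The bound 1/2 keeps \<open>\<delta>\<close> away from 1, so that its powers absorb
  constants: every constant is bounded, and nonzero constants are not negligible.\<close>

locale nonarch_scale = nonarch_local_field v for v :: "'k::local_field \<Rightarrow> real" +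
  fixes U :: "'i filter" and \<delta> :: "'i \<Rightarrow> real"
  assumes ultra: "ultrafilter U"
    and scale_pos: "\<delta> i > 0"
    and scale_le: "\<delta> i \<le> 1 / 2"
begin

text \<open>Vanishing in the field \<open>K\<close>. The quotient is never formed: equality in
  \<open>K\<close> is expressed by a negligible difference of bounded functions.\<close>

definition negl :: "('i \<Rightarrow> 'k) \<Rightarrow> bool" where
  "negl a \<longleftrightarrow> (\<forall>m. \<forall>\<^sub>F i in U. v (a i) \<le> \<delta> i ^ m)"

definition bdd :: "('i \<Rightarrow> 'k) \<Rightarrow> bool" where
  "bdd a \<longleftrightarrow> (\<exists>m. \<forall>\<^sub>F i in U. v (a i) \<le> (1 / \<delta> i) ^ m)"

lemma inverse_scale_ge: "1 / \<delta> i \<ge> 2"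
  using scale_pos[of i] scale_le[of i] by (simp add: field_simps)

lemma scale_power_le: "m \<le> n \<Longrightarrow> \<delta> i ^ n \<le> \<delta> i ^ m"
  using scale_pos[of i] scale_le[of i] by (intro power_decreasing) auto

lemma inverse_scale_power_le: "m \<le> n \<Longrightarrow> (1 / \<delta> i) ^ m \<le> (1 / \<delta> i) ^ n"
  using inverse_scale_ge[of i] by (intro power_increasing) auto

text \<open>The ultrafilter property turns the negated statement into an eventual one. A
  non-negligible function thus exceeds one fixed power of \<open>\<delta>\<close> eventually, so it
  is invertible in \<open>K\<close>.\<close>

lemma not_negl_iff: "\<not> negl a \<longleftrightarrow> (\<exists>m. \<forall>\<^sub>F i in U. \<delta> i ^ m < v (a i))"
  unfolding negl_def by (simp add: ultrafilter_not_eventually[OF ultra] not_le)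

lemma neglD: "negl a \<Longrightarrow> \<forall>\<^sub>F i in U. v (a i) \<le> \<delta> i ^ m"
  by (simp add: negl_def)

section \<open>The ring of bounded functions and the ideal of negligible ones\<close>

lemma negl_zero [simp]: "negl (\<lambda>i. 0)"
  using scale_pos by (simp add: negl_def less_imp_le)

lemma negl_add: "negl a \<Longrightarrow> negl b \<Longrightarrow> negl (\<lambda>i. a i + b i)"
  unfolding negl_def
proof (intro allI)
  fix m assume "\<forall>m. \<forall>\<^sub>F i in U. v (a i) \<le> \<delta> i ^ m" "\<forall>m. \<forall>\<^sub>F i in U. v (b i) \<le> \<delta> i ^ m"
  then have "\<forall>\<^sub>F i in U. v (a i) \<le> \<delta> i ^ m" "\<forall>\<^sub>F i in U. v (b i) \<le> \<delta> i ^ m" by auto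
  then show "\<forall>\<^sub>F i in U. v (a i + b i) \<le> \<delta> i ^ m"
    by eventually_elim (rule v_add_le)
qed

lemma negl_minus: "negl (\<lambda>i. - a i) \<longleftrightarrow> negl a"
  by (simp add: negl_def)

lemma negl_diff: "negl a \<Longrightarrow> negl b \<Longrightarrow> negl (\<lambda>i. a i - b i)"
  using negl_add[of a "\<lambda>i. - b i"] by (simp add: negl_minus)

lemma negl_sum: "(\<And>k. k \<in> A \<Longrightarrow> negl (f k)) \<Longrightarrow> negl (\<lambda>i. \<Sum>k\<in>A. f k i)"
  by (induction A rule: infinite_finite_induct) (simp_all add: negl_add)

lemma negl_imp_bdd: "negl a \<Longrightarrow> bdd a"
  using neglD[of a 0] unfolding bdd_def by (intro exI[of _ 0]) simp

lemma bdd_const: "bdd (\<lambda>i. c)"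
proof -
  obtain m where m: "v c < 2 ^ m" using real_arch_pow[of 2 "v c"] by auto
  have "v c \<le> (1 / \<delta> i) ^ m" for i
    using m power_mono[OF inverse_scale_ge[of i], of m] by linarith
  then show ?thesis unfolding bdd_def by (intro exI[of _ m]) simp
qed

lemma bdd_add:
  assumes "bdd a" "bdd b"
  shows "bdd (\<lambda>i. a i + b i)"
proof -
  obtain m n where "\<forall>\<^sub>F i in U. v (a i) \<le> (1 / \<delta> i) ^ m" "\<forall>\<^sub>F i in U. v (b i) \<le> (1 / \<delta> i) ^ n"
    using assms unfolding bdd_def by blast
  then have "\<forall>\<^sub>F i in U. v (a i + b i) \<le> (1 / \<delta> i) ^ (m + n)"
  proof eventually_elim
    case (elim i)
    then show ?case
      using inverse_scale_power_le[of m "m + n" i] inverse_scale_power_le[of n "m + n" i]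
      by (intro v_add_le) linarith+
  qed
  then show ?thesis unfolding bdd_def by blast
qed

lemma bdd_mult:
  assumes "bdd a" "bdd b"
  shows "bdd (\<lambda>i. a i * b i)"
proof -
  obtain m n where "\<forall>\<^sub>F i in U. v (a i) \<le> (1 / \<delta> i) ^ m" "\<forall>\<^sub>F i in U. v (b i) \<le> (1 / \<delta> i) ^ n"
    using assms unfolding bdd_def by blast
  then have "\<forall>\<^sub>F i in U. v (a i * b i) \<le> (1 / \<delta> i) ^ (m + n)"
  proof eventually_elim
    case (elim i)
    then show ?case
      using scale_pos[of i] unfolding mult power_add by (intro mult_mono) (simp_all add: nonneg)
  qed
  then show ?thesis unfolding bdd_def by blast
qed

lemma bdd_power: "bdd a \<Longrightarrow> bdd (\<lambda>i. a i ^ n)"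
  by (induction n) (simp_all add: bdd_const bdd_mult)

lemma bdd_sum: "(\<And>k. k \<in> A \<Longrightarrow> bdd (f k)) \<Longrightarrow> bdd (\<lambda>i. \<Sum>k\<in>A. f k i)"
  by (induction A rule: infinite_finite_induct) (simp_all add: bdd_add bdd_const)

lemma bdd_diff: "bdd a \<Longrightarrow> bdd b \<Longrightarrow> bdd (\<lambda>i. a i - b i)"
  using bdd_add[of a "\<lambda>i. (-1) * b i"] bdd_mult[OF bdd_const, of b "-1"] by simp

lemma negl_mult:
  assumes "negl a" "bdd b"
  shows "negl (\<lambda>i. a i * b i)"
  unfolding negl_def
proof
  fix m
  obtain n where n: "\<forall>\<^sub>F i in U. v (b i) \<le> (1 / \<delta> i) ^ n"
    using assms(2) unfolding bdd_def by blast
  show "\<forall>\<^sub>F i in U. v (a i * b i) \<le> \<delta> i ^ m"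
    using n neglD[OF assms(1), of "m + n"]
  proof eventually_elim
    case (elim i)
    have "v (a i * b i) \<le> \<delta> i ^ (m + n) * (1 / \<delta> i) ^ n"
      using elim scale_pos[of i] unfolding mult by (intro mult_mono) (simp_all add: nonneg)
    also have "\<dots> = \<delta> i ^ m"
      using scale_pos[of i] by (simp add: power_add power_divide)
    finally show ?case .
  qed
qed

lemma negl_mult_left: "bdd a \<Longrightarrow> negl b \<Longrightarrow> negl (\<lambda>i. a i * b i)"
  using negl_mult[of b a] by (simp add: mult.commute)

lemma not_negl_mult:
  assumes "\<not> negl a" "\<not> negl b"
  shows "\<not> negl (\<lambda>i. a i * b i)"
proof -
  obtain m n where "\<forall>\<^sub>F i in U. \<delta> i ^ m < v (a i)" "\<forall>\<^sub>F i in U. \<delta> i ^ n < v (b i)"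
    using assms unfolding not_negl_iff by blast
  then have "\<forall>\<^sub>F i in U. \<delta> i ^ (m + n) < v (a i * b i)"
  proof eventually_elim
    case (elim i)
    then show ?case
      using scale_pos[of i] unfolding mult power_add by (intro mult_strict_mono') (simp_all add: less_imp_le)
  qed
  then show ?thesis unfolding not_negl_iff by blast
qed

lemma not_negl_const:
  assumes "c \<noteq> 0"
  shows "\<not> negl (\<lambda>i. c)"
proof -
  obtain m where m: "(1 / 2) ^ m < v c"
    using real_arch_pow_inv[OF v_pos[OF assms], of "1 / 2"] by auto
  have "\<delta> i ^ m < v c" for i
    using m power_mono[OF scale_le[of i], of m] scale_pos[of i] by linarith
  then show ?thesis unfolding not_negl_iff by (intro exI[of _ m]) simp
qed

lemma not_negl_power: "\<not> negl a \<Longrightarrow> \<not> negl (\<lambda>i. a i ^ n)"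
  by (induction n) (simp_all add: not_negl_const not_negl_mult)

lemma not_negl_cong:
  assumes "\<not> negl a" "negl (\<lambda>i. a i - b i)"
  shows "\<not> negl b"
  using negl_add[OF assms(2), of b] assms(1) by auto

lemma not_negl_imp_nonzero:
  assumes "\<not> negl a"
  shows "\<forall>\<^sub>F i in U. a i \<noteq> 0"
proof -
  obtain m where "\<forall>\<^sub>F i in U. \<delta> i ^ m < v (a i)"
    using assms unfolding not_negl_iff by blast
  then show ?thesis
  proof eventually_elim
    case (elim i)
    then show ?case using scale_pos[of i] by (auto dest: zero_less_power[of _ m])
  qed
qed

section \<open>Polynomials in bounded functions\<close>

lemma bdd_coord_poly:
  assumes "coord_poly J f" "\<And>j. j \<in> J \<Longrightarrow> bdd (\<lambda>i. x i j)"
  shows "bdd (\<lambda>i. f (x i))"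
  using assms by induction (simp_all add: bdd_const bdd_add bdd_mult)

lemma negl_diff_coord_poly:
  assumes "coord_poly J f" "\<And>j. j \<in> J \<Longrightarrow> bdd (\<lambda>i. x i j)"
    "\<And>j. j \<in> J \<Longrightarrow> bdd (\<lambda>i. y i j)" "\<And>j. j \<in> J \<Longrightarrow> negl (\<lambda>i. x i j - y i j)"
  shows "negl (\<lambda>i. f (x i) - f (y i))"
  using assms(1)
proof induction
  case (add f g)
  from negl_add[OF add.IH] show ?case by (simp add: algebra_simps)
next
  case (mult f g)
  have "negl (\<lambda>i. (f (x i) - f (y i)) * g (x i) + f (y i) * (g (x i) - g (y i)))"
    using mult bdd_coord_poly[OF mult.hyps(2), of x] bdd_coord_poly[OF mult.hyps(1), of y] assms(2,3)
    by (intro negl_add negl_mult negl_mult_left) auto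
  then show ?case by (simp add: algebra_simps)
qed (simp_all add: assms)

lemma bdd_poly:
  assumes F: "poly_family J n F" and x: "\<And>j. j \<in> J \<Longrightarrow> bdd (\<lambda>i. x i j)" and y: "bdd y"
  shows "bdd (\<lambda>i. poly (F (x i)) (y i))"
proof -
  have "bdd (\<lambda>i. coeff (F (x i)) m)" for m
    using F x by (intro bdd_coord_poly[where f = "\<lambda>z. coeff (F z) m" for m]) (auto simp: poly_family_def)
  then have "bdd (\<lambda>i. \<Sum>m<n. coeff (F (x i)) m * y i ^ m)"
    by (intro bdd_sum bdd_mult bdd_power y)
  moreover have "poly (F (x i)) (y i) = (\<Sum>m<n. coeff (F (x i)) m * y i ^ m)" for i
    using F by (intro poly_eq_sum_lessThan) (simp add: poly_family_def)
  ultimately show ?thesis by simp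
qed

lemma negl_poly:
  assumes F: "\<And>z i. i \<ge> n \<Longrightarrow> coeff (F z) i = 0" and c: "\<And>m. negl (\<lambda>i. coeff (F i) m)" and y: "bdd y"
  shows "negl (\<lambda>i. poly (F i) (y i))"
proof -
  have "negl (\<lambda>i. \<Sum>m<n. coeff (F i) m * y i ^ m)"
    by (intro negl_sum negl_mult bdd_power y c)
  moreover have "poly (F i) (y i) = (\<Sum>m<n. coeff (F i) m * y i ^ m)" for i
    using F by (intro poly_eq_sum_lessThan) simp
  ultimately show ?thesis by simp
qed

lemma negl_pderiv:
  assumes F: "\<And>z i. i \<ge> n \<Longrightarrow> coeff (F z) i = 0" and c: "\<And>m. negl (\<lambda>i. coeff (F i) m)" and y: "bdd y"
  shows "negl (\<lambda>i. poly (pderiv (F i)) (y i))"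
proof (rule negl_poly[OF _ _ y])
  show "coeff (pderiv (F z)) i = 0" if "i \<ge> n" for z i
    using F[of "Suc i"] that by (simp add: coeff_pderiv)
  show "negl (\<lambda>i. coeff (pderiv (F i)) m)" for m
    unfolding coeff_pderiv by (intro negl_mult_left bdd_const c)
qed

text \<open>Separability of \<open>K / k\<close>, with p for the characteristic. Expanding the
  \<open>c e\<close> in a basis \<open>Bs\<close> over the field of p-th powers turns the sum into
  one of terms \<open>h i b ^ p * b\<close> with \<open>h i b\<close> linear in the
  \<open>g e i\<close>. By independence and compactness the sum bounds every
  \<open>v (h i b) ^ p\<close> up to a constant, so each \<open>h i b\<close> is negligible, and one
  of them is a nontrivial relation.\<close>

lemma frobenius_descent:
  fixes c :: "'a \<Rightarrow> 'k" and g :: "'a \<Rightarrow> 'i \<Rightarrow> 'k"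
  assumes p: "CHAR('k) > 0" and E: "finite E" "e0 \<in> E" "c e0 \<noteq> 0"
    and negl: "negl (\<lambda>i. \<Sum>e\<in>E. c e * g e i ^ CHAR('k))"
  shows "\<exists>u. (\<exists>e\<in>E. u e \<noteq> 0) \<and> negl (\<lambda>i. \<Sum>e\<in>E. u e * g e i)"
proof -
  let ?p = "CHAR('k)"
  have prime: "prime ?p" using p by (rule prime_CHAR_semidom)
  have frobenius_add: "(a + b) ^ ?p = a ^ ?p + b ^ ?p" for a b :: 'k
    by (rule freshmans_dream[OF prime refl])
  \<comment> \<open>The scalar \<open>a\<close> acts as its p-th power, so span and independence are
    those over the subfield of p-th powers.\<close>
  interpret frob: vector_space "\<lambda>a x::'k. a ^ ?p * x"
    by unfold_locales
      (simp_all add: frobenius_add distrib_left distrib_right power_mult_distrib mult.assoc)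
  obtain Bs where Bs: "Bs \<subseteq> c ` E" "frob.independent Bs" "c ` E \<subseteq> frob.span Bs"
    using frob.maximal_independent_subset[of "c ` E"] by blast
  have fin: "finite Bs" using finite_subset[OF Bs(1)] E(1) by simp
  have "\<exists>r. c e = (\<Sum>b\<in>Bs. r b ^ ?p * b)" if "e \<in> E" for e
    using Bs(3) that unfolding frob.span_finite[OF fin] by auto
  then obtain r where r: "\<And>e. e \<in> E \<Longrightarrow> c e = (\<Sum>b\<in>Bs. r e b ^ ?p * b)" by metis
  define h where "h i b = (\<Sum>e\<in>E. r e b * g e i)" for i b
  define \<phi> where "\<phi> z = v (\<Sum>b\<in>Bs. z b ^ ?p * b)" for z
  have sum_h: "v (\<Sum>e\<in>E. c e * g e i ^ ?p) = \<phi> (h i)" for i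
  proof -
    have "(\<Sum>e\<in>E. c e * g e i ^ ?p) = (\<Sum>e\<in>E. \<Sum>b\<in>Bs. (r e b * g e i) ^ ?p * b)"
    proof (rule sum.cong[OF refl])
      fix e assume "e \<in> E"
      show "c e * g e i ^ ?p = (\<Sum>b\<in>Bs. (r e b * g e i) ^ ?p * b)"
        unfolding r[OF \<open>e \<in> E\<close>] sum_distrib_right
        by (intro sum.cong refl) (simp add: power_mult_distrib mult_ac)
    qed
    also have "\<dots> = (\<Sum>b\<in>Bs. (\<Sum>e\<in>E. (r e b * g e i) ^ ?p) * b)"
      by (subst sum.swap) (simp add: sum_distrib_right)
    also have "\<dots> = (\<Sum>b\<in>Bs. h i b ^ ?p * b)"
      unfolding h_def using prime by (simp add: freshmans_dream_sum)
    finally show ?thesis by (simp add: \<phi>_def)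
  qed
  have cont: "continuous_on UNIV \<phi>"
  proof -
    have "continuous_on UNIV (\<lambda>z::'k \<Rightarrow> 'k. z b ^ n)" for b n
      by (induction n) (auto intro!: continuous_intros)
    then show ?thesis unfolding \<phi>_def by (intro continuous_intros)
  qed
  have "\<exists>C>0. \<forall>z. \<forall>b\<in>Bs. C * v (z b) ^ ?p \<le> \<phi> z"
  proof (rule homogeneous_lower_bound[OF fin p cont])
    show "\<phi> (\<lambda>b. a * z b) = v a ^ ?p * \<phi> z" for a z
    proof -
      have "(\<Sum>b\<in>Bs. (a * z b) ^ ?p * b) = a ^ ?p * (\<Sum>b\<in>Bs. z b ^ ?p * b)"
        unfolding sum_distrib_left by (intro sum.cong refl) (simp add: power_mult_distrib)
      then show ?thesis by (simp add: \<phi>_def mult v_power)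
    qed
    show "z b = 0" if "\<phi> z = 0" "b \<in> Bs" for z b
      using frob.independentD[OF Bs(2) fin order_refl _ that(2), of z] that(1)
      by (simp add: \<phi>_def eq_0_iff)
    show "\<phi> (\<lambda>b. if b \<in> Bs then z b else 0) = \<phi> z" for z
      unfolding \<phi>_def by (intro arg_cong[where f = v] sum.cong) auto
  qed (simp add: \<phi>_def nonneg)
  then obtain C where C: "C > 0" "\<And>z b. b \<in> Bs \<Longrightarrow> C * v (z b) ^ ?p \<le> \<phi> z" by blast
  obtain k where k: "(1 / 2) ^ k < C" using real_arch_pow_inv[OF C(1), of "1 / 2"] by auto
  have "negl (\<lambda>i. h i b)" if b: "b \<in> Bs" for b
    unfolding negl_def
  proof
    fix m
    show "\<forall>\<^sub>F i in U. v (h i b) \<le> \<delta> i ^ m"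
      \<comment> \<open>The factor \<open>\<delta> i ^ k\<close> absorbs \<open>C\<close>; the
        remaining factor is the p-th power of \<open>\<delta> i ^ m\<close>.\<close>
      using neglD[OF negl, of "k + m * ?p"]
    proof eventually_elim
      case (elim i)
      have "C * v (h i b) ^ ?p \<le> \<delta> i ^ (k + m * ?p)"
        using C(2)[OF b, of "h i"] elim by (simp add: sum_h)
      also have "\<dots> = \<delta> i ^ k * (\<delta> i ^ m) ^ ?p" by (simp add: power_add power_mult)
      also have "\<delta> i ^ k \<le> C"
        using k power_mono[OF scale_le[of i], of k] scale_pos[of i] by linarith
      then have "\<delta> i ^ k * (\<delta> i ^ m) ^ ?p \<le> C * (\<delta> i ^ m) ^ ?p"
        using scale_pos[of i] by (intro mult_right_mono) simp_all
      finally have "v (h i b) ^ ?p \<le> (\<delta> i ^ m) ^ ?p" using C(1) by simp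
      then show ?case using p scale_pos[of i] nonneg[of "h i b"]
        by (simp add: power_mono_iff)
    qed
  qed
  moreover obtain b where "b \<in> Bs" "r e0 b \<noteq> 0"
    using r[OF E(2)] E(3) p by (auto elim: sum.not_neutral_contains_not_neutral)
  ultimately show ?thesis using E(2) unfolding h_def
    by (intro exI[of _ "\<lambda>e. r e b"]) auto
qed

text \<open>A nonzero polynomial over \<open>k\<close> vanishing at the point of \<open>K\<close>
  given by \<open>x\<close>; \<open>D\<close> bounds its total degree and serves as the quantity to
  minimise.\<close>

definition algebraic_relation :: "'j set \<Rightarrow> ('i \<Rightarrow> 'j \<Rightarrow> 'k) \<Rightarrow> nat \<Rightarrow> bool" where
  "algebraic_relation J x D \<longleftrightarrow> (\<exists>E c. finite E \<and> E \<noteq> {} \<and> E \<subseteq> exponents J \<and>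
    (\<forall>e\<in>E. c e \<noteq> 0 \<and> sum e J \<le> D) \<and> negl (\<lambda>i. \<Sum>e\<in>E. c e * mon J e (x i)))"

lemma algebraic_relationI:
  assumes A: "finite A" "inj_on g A" "\<And>a. a \<in> A \<Longrightarrow> g a \<in> exponents J"
      "\<And>a. a \<in> A \<Longrightarrow> c a \<noteq> 0 \<Longrightarrow> sum (g a) J \<le> D" "a0 \<in> A" "c a0 \<noteq> 0"
    and negl: "negl (\<lambda>i. \<Sum>a\<in>A. c a * mon J (g a) (x i))"
  shows "algebraic_relation J x D"
proof -
  define A' where "A' = {a \<in> A. c a \<noteq> 0}"
  have A': "A' \<subseteq> A" "inj_on g A'" "finite A'" "a0 \<in> A'"
    using A inj_on_subset[OF A(2), of A'] by (auto simp: A'_def)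
  define c' where "c' = c \<circ> the_inv_into A' g"
  have c': "c' (g a) = c a" if "a \<in> A'" for a
    using that A'(2) by (simp add: c'_def the_inv_into_f_f)
  have "(\<Sum>a\<in>A. c a * mon J (g a) (x i)) = (\<Sum>a\<in>A'. c a * mon J (g a) (x i))" for i
    using A(1) by (intro sum.mono_neutral_right) (auto simp: A'_def)
  also have "\<dots> i = (\<Sum>e\<in>g ` A'. c' e * mon J e (x i))" for i
    by (simp add: sum.reindex[OF A'(2)] c')
  finally have "negl (\<lambda>i. \<Sum>e\<in>g ` A'. c' e * mon J e (x i))" using negl by simp
  moreover have "finite (g ` A')" "g ` A' \<noteq> {}" "g ` A' \<subseteq> exponents J"
    using A'(1,3,4) A(3) by auto
  moreover have "\<forall>e\<in>g ` A'. c' e \<noteq> 0 \<and> sum e J \<le> D"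
    using A(4) c' by (auto simp: A'_def)
  ultimately show ?thesis unfolding algebraic_relation_def by blast
qed

lemma not_algebraic_relation_0:
  assumes "finite J"
  shows "\<not> algebraic_relation J x 0"
proof
  assume "algebraic_relation J x 0"
  then obtain E c where E: "E \<noteq> {}" "E \<subseteq> exponents J" "\<forall>e\<in>E. c e \<noteq> 0 \<and> sum e J \<le> 0"
    "negl (\<lambda>i. \<Sum>e\<in>E. c e * mon J e (x i))"
    unfolding algebraic_relation_def by blast
  have "e = (\<lambda>_. 0)" if "e \<in> E" for e
  proof
    fix j
    have "e \<in> exponents J" "sum e J = 0" using E(2,3) that by auto
    then show "e j = 0" using assms by (cases "j \<in> J") (simp_all add: exponents_def)
  qed
  with E(1) have "E = {\<lambda>_. 0}" by blast
  with E(3,4) not_negl_const[of "c (\<lambda>_. 0)"] show False by simp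
qed

text \<open>Take a relation of least total degree. If all its partial derivatives vanish at
  \<open>x\<close>, minimality makes them trivial, so every exponent is divisible by the
  characteristic. In characteristic 0 this leaves a nonzero constant; otherwise
  \<open>frobenius_descent\<close> extracts a p-th root, a relation of smaller degree.\<close>

lemma ex_simple_root:
  fixes x :: "'i \<Rightarrow> 'j \<Rightarrow> 'k"
  assumes J: "finite J" and alg: "algebraic_relation J x D0"
  shows "\<exists>j\<in>J. \<exists>n F. poly_family (J - {j}) n F \<and> negl (\<lambda>i. poly (F (x i)) (x i j)) \<and>
    \<not> negl (\<lambda>i. poly (pderiv (F (x i))) (x i j))"
proof (rule ccontr)
  assume neg: "\<not> ?thesis"
  define D where "D = (LEAST D. algebraic_relation J x D)"
  have "algebraic_relation J x D" unfolding D_def using alg by (rule LeastI)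
  then obtain E c where E: "finite E" "E \<noteq> {}" "E \<subseteq> exponents J"
    "\<And>e. e \<in> E \<Longrightarrow> c e \<noteq> 0" "\<And>e. e \<in> E \<Longrightarrow> sum e J \<le> D"
    and E_negl: "negl (\<lambda>i. \<Sum>e\<in>E. c e * mon J e (x i))"
    unfolding algebraic_relation_def by auto
  have D: "D > 0"
    using \<open>algebraic_relation J x D\<close> not_algebraic_relation_0[OF J, of x] by (cases D) auto
  have min: "\<not> algebraic_relation J x (D - 1)"
    using D not_less_Least[of "D - 1" "algebraic_relation J x"] by (simp add: D_def)
  have dvd: "CHAR('k) dvd e j" if "e \<in> E" "j \<in> J" for e j
  proof (cases "e j = 0")
    case False
    \<comment> \<open>The relation read as a polynomial in the coordinate \<open>j\<close>.\<close>
    define F where "F z = (\<Sum>e\<in>E. monom (c e * mon (J - {j}) e z) (e j))" for z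
    have "poly_family (J - {j}) (Suc (e j)) (\<lambda>z. monom (c e * mon (J - {j}) e z) (e j))" for e
      by (intro poly_family_monom coord_poly.mult coord_poly.const coord_poly_mon)
    moreover have "Suc (e j) \<le> Suc (\<Sum>e\<in>E. e j)" if "e \<in> E" for e
      using E(1) that by (simp add: member_le_sum[of e E "\<lambda>e. e j"])
    ultimately have fam: "poly_family (J - {j}) (Suc (\<Sum>e\<in>E. e j)) F"
      unfolding F_def[abs_def] by (intro poly_family_sum) (rule poly_family_mono)
    have "poly (F z) (z j) = (\<Sum>e\<in>E. c e * mon J e z)" for z
      unfolding F_def poly_sum poly_monom mon_remove[OF J \<open>j \<in> J\<close>] by (simp add: mult_ac)
    then have "negl (\<lambda>i. poly (F (x i)) (x i j))" using E_negl by simp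
    with fam have "negl (\<lambda>i. poly (pderiv (F (x i))) (x i j))"
      using neg \<open>j \<in> J\<close> by blast
    \<comment> \<open>Terms with \<open>e j = 0\<close> are removed: truncated subtraction would
      send the exponents 0 and 1 of \<open>z j\<close> to the same value and spoil
      injectivity.\<close>
    moreover have "poly (pderiv (F z)) (z j) =
      (\<Sum>e | e \<in> E \<and> e j \<noteq> 0. (of_nat (e j) * c e) * mon J (e(j := e j - 1)) z)" for z
    proof -
      have "poly (pderiv (F z)) (z j) =
        (\<Sum>e\<in>E. of_nat (e j) * c e * (z j ^ (e j - 1) * mon (J - {j}) e z))"
        unfolding F_def by (simp add: higher_pderiv_sum[of 1, simplified] poly_sum pderiv_monom poly_monom mult_ac)
      also have "\<dots> = (\<Sum>e\<in>E. of_nat (e j) * c e * mon J (e(j := e j - 1)) z)"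
        unfolding mon_remove[OF J \<open>j \<in> J\<close>] by (intro sum.cong) (auto simp: mon_def intro!: prod.cong)
      also have "\<dots> = (\<Sum>e | e \<in> E \<and> e j \<noteq> 0. of_nat (e j) * c e * mon J (e(j := e j - 1)) z)"
        using E(1) by (intro sum.mono_neutral_right) auto
      finally show ?thesis .
    qed
    ultimately have negl': "negl (\<lambda>i. \<Sum>e | e \<in> E \<and> e j \<noteq> 0.
      (of_nat (e j) * c e) * mon J (e(j := e j - 1)) (x i))" by simp
    have "of_nat (e j) * c e = 0"
    proof (rule ccontr)
      assume nz: "of_nat (e j) * c e \<noteq> 0"
      have "algebraic_relation J x (D - 1)"
      proof (rule algebraic_relationI[OF _ _ _ _ _ nz negl'])
        show "inj_on (\<lambda>e. e(j := e j - 1)) {e \<in> E. e j \<noteq> 0}"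
        proof (rule inj_onI)
          fix e d :: "'j \<Rightarrow> nat"
          assume ed: "e \<in> {e \<in> E. e j \<noteq> 0}" "d \<in> {e \<in> E. e j \<noteq> 0}" "e(j := e j - 1) = d(j := d j - 1)"
          have "e i = d i" for i
            using fun_cong[OF ed(3), of i] ed(1,2) by (cases "i = j") auto
          then show "e = d" by blast
        qed
        fix e assume e: "e \<in> {e \<in> E. e j \<noteq> 0}"
        then show "e(j := e j - 1) \<in> exponents J" using E(3) \<open>j \<in> J\<close> by (auto simp: exponents_def)
        have "sum (e(j := e j - 1)) J = (e j - 1) + sum e (J - {j})"
          using J \<open>j \<in> J\<close> by (simp add: sum.remove[of J j])
        moreover have "sum e J = e j + sum e (J - {j})"
          using J \<open>j \<in> J\<close> by (simp add: sum.remove[of J j])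
        ultimately show "sum (e(j := e j - 1)) J \<le> D - 1" using e E(5)[of e] by auto
      qed (use E(1) that False in auto)
      with min show False by blast
    qed
    with E(4)[OF \<open>e \<in> E\<close>] show ?thesis by (simp add: of_nat_eq_0_iff_char_dvd)
  qed simp
  \<comment> \<open>A nonzero exponent divisible by the characteristic rules out characteristic
    0.\<close>
  have "\<exists>e\<in>E. \<exists>j\<in>J. e j \<noteq> 0"
  proof (rule ccontr)
    assume "\<not> ?thesis"
    then have "algebraic_relation J x 0"
      unfolding algebraic_relation_def using E E_negl by (intro exI[of _ E] exI[of _ c]) auto
    with not_algebraic_relation_0[OF J] show False by blast
  qed
  then obtain e j where "e \<in> E" "j \<in> J" "e j \<noteq> 0" by blast
  with dvd[of e j] have p: "CHAR('k) > 0" by (intro gr0I) simp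
  define q where "q e = (\<lambda>j. e j div CHAR('k))" for e :: "'j \<Rightarrow> nat"
  have e_q: "e j = CHAR('k) * q e j" if "e \<in> E" for e j
    using dvd[OF that] E(3) that by (cases "j \<in> J") (auto simp: q_def exponents_def)
  have "mon J e z = mon J (q e) z ^ CHAR('k)" if "e \<in> E" for e and z :: "'j \<Rightarrow> 'k"
  proof -
    have "z j ^ e j = (z j ^ q e j) ^ CHAR('k)" for j
      by (subst e_q[OF that]) (simp only: mult.commute[of "CHAR('k)"] power_mult)
    then show ?thesis by (simp add: mon_def prod_power_distrib)
  qed
  then have "(\<Sum>e\<in>E. c e * mon J (q e) (x i) ^ CHAR('k)) = (\<Sum>e\<in>E. c e * mon J e (x i))" for i
    by (intro sum.cong) auto
  then have "negl (\<lambda>i. \<Sum>e\<in>E. c e * mon J (q e) (x i) ^ CHAR('k))" using E_negl by simp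
  moreover obtain e0 where "e0 \<in> E" using E(2) by blast
  ultimately obtain u e where u: "e \<in> E" "u e \<noteq> 0" "negl (\<lambda>i. \<Sum>e\<in>E. u e * mon J (q e) (x i))"
    using frobenius_descent[OF p E(1), of e0 c "\<lambda>e i. mon J (q e) (x i)"] E(4) by blast
  have "algebraic_relation J x (D - 1)"
  proof (rule algebraic_relationI[OF E(1) _ _ _ u])
    show "inj_on q E"
    proof (rule inj_onI)
      fix e d assume "e \<in> E" "d \<in> E" "q e = q d"
      then have "e j = d j" for j using e_q[of e j] e_q[of d j] by simp
      then show "e = d" by blast
    qed
    fix e assume e: "e \<in> E"
    then show "q e \<in> exponents J" using E(3) by (auto simp: q_def exponents_def)
    have "sum e J = CHAR('k) * sum (q e) J"
      by (simp add: e_q[OF e] sum_distrib_left)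
    moreover have "CHAR('k) \<ge> 2" using prime_CHAR_semidom[OF p] by (rule prime_ge_2_nat)
    ultimately have "2 * sum (q e) J \<le> D" using E(5)[OF e] mult_le_mono1[of 2 "CHAR('k)" "sum (q e) J"] by linarith
    then show "sum (q e) J \<le> D - 1" using D by linarith
  qed
  with min show False by blast
qed

subsection \<open>Lifting approximate zeros\<close>

text \<open>Over \<open>K\<close> the polynomial \<open>G\<close> has degree exactly
  \<open>d\<close>, its leading coefficient being nonzero there, and \<open>y\<close> is a
  root.\<close>

definition annihilating :: "'j set \<Rightarrow> ('i \<Rightarrow> 'j \<Rightarrow> 'k) \<Rightarrow> ('i \<Rightarrow> 'k) \<Rightarrow> nat \<Rightarrow> (('j \<Rightarrow> 'k) \<Rightarrow> 'k poly) \<Rightarrow> bool" where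
  "annihilating J x y d G \<longleftrightarrow> poly_family J (Suc d) G \<and> \<not> negl (\<lambda>i. coeff (G (x i)) d) \<and>
    negl (\<lambda>i. poly (G (x i)) (y i))"

text \<open>Negligible top coefficients are stripped one by one; since \<open>y\<close> is bounded
  this changes the value at \<open>y\<close> negligibly. The coefficient at \<open>m\<close>
  survives, so a non-negligible leading coefficient is reached.\<close>

lemma ex_annihilating:
  assumes F: "poly_family J n F" and root: "negl (\<lambda>i. poly (F (x i)) (y i))" and y: "bdd y"
    and nz: "\<not> negl (\<lambda>i. coeff (F (x i)) m)"
  shows "\<exists>d<n. \<exists>G. annihilating J x y d G"
  using F root nz
proof (induction n arbitrary: F)
  case 0
  then have "coeff (F z) m = 0" for z by (simp add: poly_family_def)
  with 0 show ?case by simp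
next
  case (Suc n)
  show ?case
  proof (cases "negl (\<lambda>i. coeff (F (x i)) n)")
    case False
    with Suc.prems have "annihilating J x y n F" by (simp add: annihilating_def)
    then show ?thesis by blast
  next
    case True
    define G where "G z = F z - monom (coeff (F z) n) n" for z
    have G: "coeff (G z) i = (if i = n then 0 else coeff (F z) i)" for z i
      by (simp add: G_def)
    have "coord_poly J (\<lambda>z. coeff (G z) i)" for i
      using Suc.prems(1) unfolding G by (cases "i = n") (simp_all add: poly_family_def coord_poly.const)
    then have "poly_family J n G"
      using Suc.prems(1) by (simp add: poly_family_def G)
    moreover have "negl (\<lambda>i. poly (F (x i)) (y i) - coeff (F (x i)) n * y i ^ n)"
      using True y Suc.prems(2) by (intro negl_diff negl_mult bdd_power)
    then have "negl (\<lambda>i. poly (G (x i)) (y i))" by (simp add: G_def poly_monom)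
    moreover have "m \<noteq> n" using Suc.prems(3) True by blast
    then have "\<not> negl (\<lambda>i. coeff (G (x i)) m)" using Suc.prems(3) by (simp add: G)
    ultimately show ?thesis using Suc.IH less_SucI by blast
  qed
qed

text \<open>Hensel's lemma at almost every \<open>i\<close>, with a power of
  \<open>1 / \<delta> i\<close> as the size bound. The derivative exceeds a fixed power of
  \<open>\<delta> i\<close>, while the value lies below every power; so the hypotheses hold and the
  displacement is negligible.\<close>

lemma hensel_negl:
  assumes c: "\<And>m. bdd (\<lambda>i. coeff (p i) m)" and n: "\<And>i m. m \<ge> n \<Longrightarrow> coeff (p i) m = 0"
    and y: "bdd y" and root: "negl (\<lambda>i. poly (p i) (y i))"
    and simple: "\<not> negl (\<lambda>i. poly (pderiv (p i)) (y i))"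
  shows "\<exists>z. negl (\<lambda>i. z i - y i) \<and> (\<forall>\<^sub>F i in U. poly (p i) (z i) = 0)"
proof -
  obtain M where M: "\<And>m. \<forall>\<^sub>F i in U. v (coeff (p i) m) \<le> (1 / \<delta> i) ^ M m"
    using c unfolding bdd_def by metis
  obtain L where L: "\<forall>\<^sub>F i in U. v (y i) \<le> (1 / \<delta> i) ^ L"
    using y unfolding bdd_def by blast
  obtain k where k: "\<forall>\<^sub>F i in U. \<delta> i ^ k < v (poly (pderiv (p i)) (y i))"
    using simple unfolding not_negl_iff by blast
  \<comment> \<open>One exponent for \<open>y\<close> and all \<open>n\<close> coefficients.\<close>
  define N where "N = L + (\<Sum>m<n. M m)"
  have "\<forall>\<^sub>F i in U. \<forall>m\<in>{..<n}. v (coeff (p i) m) \<le> (1 / \<delta> i) ^ M m"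
    using M by (intro eventually_ball_finite) auto
  then have "\<forall>\<^sub>F i in U. \<exists>z. poly (p i) z = 0 \<and>
      v (z - y i) \<le> v (poly (p i) (y i)) / v (poly (pderiv (p i)) (y i))"
    using L k neglD[OF root, of "N * n + 2 * k"]
  proof eventually_elim
    case (elim i)
    let ?D = "v (poly (pderiv (p i)) (y i))" and ?B = "(1 / \<delta> i) ^ N"
    have d: "\<delta> i > 0" by (rule scale_pos)
    have B: "?B \<ge> 1" using inverse_scale_ge[of i] by (intro one_le_power) simp
    have "v (coeff (p i) m) \<le> ?B" for m
    proof (cases "m < n")
      case True
      then have "M m \<le> N" using member_le_sum[of m "{..<n}" M] by (simp add: N_def)
      moreover have "v (coeff (p i) m) \<le> (1 / \<delta> i) ^ M m" using elim(1) True by blast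
      ultimately show ?thesis using inverse_scale_power_le[of "M m" N i] by linarith
    next
      case False
      then show ?thesis using n[of m i] B by simp
    qed
    moreover have "v (y i) \<le> ?B"
      using elim(2) inverse_scale_power_le[of L N i] by (simp add: N_def)
    moreover have "0 < ?D" using elim(3) zero_less_power[OF d, of k] by linarith
    then have "poly (pderiv (p i)) (y i) \<noteq> 0" by auto
    moreover have "v (poly (p i) (y i)) \<le> ?D"
      using elim(3,4) scale_power_le[of k "N * n + 2 * k" i] by simp
    moreover have "?B ^ n * v (poly (p i) (y i)) < ?D ^ 2"
    proof -
      have "?B ^ n * v (poly (p i) (y i)) \<le> ?B ^ n * \<delta> i ^ (N * n + 2 * k)"
        using elim(4) B by (intro mult_left_mono) simp_all
      also have "\<dots> = (\<delta> i ^ k) ^ 2"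
        using d by (simp add: power_add power_divide flip: power_mult) (simp add: mult.commute)
      also have "\<dots> < ?D ^ 2"
        using elim(3) d by (intro power_strict_mono) simp_all
      finally show ?thesis .
    qed
    ultimately obtain z where "poly (p i) z = 0" "v (z - y i) \<le> v (poly (p i) (y i)) / ?D"
      using n B by (rule_tac hensel[of "p i" ?B n "y i"]) auto
    then show ?case by blast
  qed
  then obtain z where z: "\<forall>\<^sub>F i in U. poly (p i) (z i) = 0 \<and>
      v (z i - y i) \<le> v (poly (p i) (y i)) / v (poly (pderiv (p i)) (y i))"
    unfolding eventually_ex by blast
  have "negl (\<lambda>i. z i - y i)"
    unfolding negl_def
  proof
    fix m
    show "\<forall>\<^sub>F i in U. v (z i - y i) \<le> \<delta> i ^ m"
      using z k neglD[OF root, of "m + k"]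
    proof eventually_elim
      case (elim i)
      have d: "\<delta> i > 0" by (rule scale_pos)
      have "v (z i - y i) \<le> v (poly (p i) (y i)) / v (poly (pderiv (p i)) (y i))" using elim(1) by blast
      also have "\<dots> \<le> \<delta> i ^ (m + k) / \<delta> i ^ k"
        using elim d by (intro frac_le) (simp_all add: nonneg)
      also have "\<dots> = \<delta> i ^ m" using d by (simp add: power_add)
      finally show ?case .
    qed
  qed
  with z show ?thesis by (auto elim: eventually_mono)
qed

text \<open>Induction on the number of coordinates. A finite system \<open>S\<close> is lifted at
  once, because eliminating a coordinate replaces each equation by all coefficients of a remainder.
  The eliminated coordinate is restored by Hensel's lemma for its minimal polynomial
  \<open>G\<close> over the others.\<close>

lemma ex_lift:
  assumes "finite J" "\<And>j. j \<in> J \<Longrightarrow> bdd (\<lambda>i. x i j)" "finite S"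
    "\<And>f. f \<in> S \<Longrightarrow> coord_poly J f" "\<And>f. f \<in> S \<Longrightarrow> negl (\<lambda>i. f (x i))"
  shows "\<exists>x'. (\<forall>j\<in>J. negl (\<lambda>i. x i j - x' i j)) \<and> (\<forall>f\<in>S. \<forall>\<^sub>F i in U. f (x' i) = 0)"
  using assms
proof (induction "card J" arbitrary: J S rule: less_induct)
  case (less J S)
  show ?case
  proof (cases "\<exists>D. algebraic_relation J x D")
    case False
    \<comment> \<open>Independent coordinates satisfy only the zero polynomial, so \<open>x\<close>
      itself already solves the system.\<close>
    have "f z = 0" if f: "f \<in> S" for f z
    proof -
      obtain E c where E: "finite E" "E \<subseteq> exponents J" "\<And>z. f z = (\<Sum>e\<in>E. c e * mon J e z)"
        using coord_poly_expand[OF less.prems(4)[OF f] less.prems(1)] by blast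
      have "c e = 0" if "e \<in> E" for e
      proof (rule ccontr)
        assume "c e \<noteq> 0"
        have "algebraic_relation J x (\<Sum>e\<in>E. sum e J)"
        proof (rule algebraic_relationI[where g = "\<lambda>e. e" and c = c, OF E(1) _ _ _ that \<open>c e \<noteq> 0\<close>])
          show "negl (\<lambda>i. \<Sum>e\<in>E. c e * mon J e (x i))"
            using less.prems(5)[OF f] by (simp add: E(3))
        qed (use E in \<open>auto intro: member_le_sum[where f = "\<lambda>e. sum e J"]\<close>)
        with False show False by blast
      qed
      then show ?thesis by (simp add: E(3))
    qed
    then show ?thesis by (intro exI[of _ x]) simp
  next
    case True
    then obtain j n F where j: "j \<in> J" and F: "poly_family (J - {j}) n F"
      "negl (\<lambda>i. poly (F (x i)) (x i j))" "\<not> negl (\<lambda>i. poly (pderiv (F (x i))) (x i j))"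
      using ex_simple_root[OF less.prems(1), of x] by blast
    define K where "K = J - {j}"
    define y where "y i = x i j" for i
    have K: "finite K" "J = insert j K" "j \<notin> K" "card K < card J"
      using less.prems(1) j card_Diff1_less[of J j] by (auto simp: K_def)
    have y: "bdd y" using less.prems(2)[OF j] by (simp add: y_def[abs_def])
    have xK: "bdd (\<lambda>i. x i k)" if "k \<in> K" for k using less.prems(2) that by (simp add: K_def)
    have F: "poly_family K n F" "negl (\<lambda>i. poly (F (x i)) (y i))"
      "\<not> negl (\<lambda>i. poly (pderiv (F (x i))) (y i))"
      using F by (simp_all add: K_def y_def)
    have Fn: "coeff (F z) m = 0" if "m \<ge> n" for z m
      using F(1) that by (simp add: poly_family_def)
    \<comment> \<open>If all coefficients of \<open>F\<close> were negligible, so would be its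
      derivative at \<open>y\<close>.\<close>
    obtain m where "\<not> negl (\<lambda>i. coeff (F (x i)) m)"
      using negl_pderiv[of n "\<lambda>i. F (x i)", OF Fn _ y] F(3) by blast
    then have ex: "\<exists>d G. annihilating K x y d G"
      using ex_annihilating[OF F(1,2) y] by blast
    define d where "d = (LEAST d. \<exists>G. annihilating K x y d G)"
    obtain G where G: "annihilating K x y d G"
      using LeastI_ex[OF ex] unfolding d_def by blast
    \<comment> \<open>Minimality of \<open>d\<close>: a family of smaller degree with root
      \<open>y\<close> is zero over \<open>K\<close>. It is applied to remainders modulo
      \<open>G\<close>.\<close>
    have min: "negl (\<lambda>i. coeff (R (x i)) m)"
      if R: "poly_family K d R" "negl (\<lambda>i. poly (R (x i)) (y i))" for R m
    proof (rule ccontr)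
      assume "\<not> ?thesis"
      then obtain d' where "d' < d" "\<exists>G. annihilating K x y d' G"
        using ex_annihilating[OF R y] by blast
      then show False unfolding d_def by (blast dest: not_less_Least)
    qed
    from G have Gf: "poly_family K (Suc d) G" and lead: "\<not> negl (\<lambda>i. coeff (G (x i)) d)"
      and Groot: "negl (\<lambda>i. poly (G (x i)) (y i))"
      unfolding annihilating_def by auto
    have g: "coord_poly K (\<lambda>z. coeff (G z) d)" using Gf by (simp add: poly_family_def)
    have remainder: "\<exists>e q Q R. poly_family K q Q \<and> poly_family K d R \<and>
        (\<forall>z. smult (coeff (G z) d ^ e) (H z) = Q z * G z + R z) \<and>
        (\<forall>m. negl (\<lambda>i. coeff (R (x i)) m))"
      if H: "poly_family K h H" "negl (\<lambda>i. poly (H (x i)) (y i))" for h H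
    proof -
      obtain e q Q R where QR: "poly_family K q Q" "poly_family K d R"
        "\<And>z. smult (coeff (G z) d ^ e) (H z) = Q z * G z + R z"
        using pseudo_division_family[OF Gf H(1)] by blast
      have "poly (R (x i)) (y i) =
          coeff (G (x i)) d ^ e * poly (H (x i)) (y i) - poly (Q (x i)) (y i) * poly (G (x i)) (y i)" for i
        using arg_cong[OF QR(3), of "\<lambda>p. poly p (y i)" "x i"] by simp
      moreover have "negl (\<lambda>i. coeff (G (x i)) d ^ e * poly (H (x i)) (y i)
          - poly (Q (x i)) (y i) * poly (G (x i)) (y i))"
        using H(2) Groot bdd_poly[OF QR(1) xK y] bdd_coord_poly[OF g xK]
        by (intro negl_diff negl_mult_left bdd_power) simp_all
      ultimately have "negl (\<lambda>i. poly (R (x i)) (y i))" by simp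
      with min[OF QR(2)] QR show ?thesis by blast
    qed
    \<comment> \<open>Separability passes from \<open>F\<close> to the minimal \<open>G\<close>:
      differentiating the division of \<open>F\<close> by \<open>G\<close>, a double root of
      \<open>G\<close> would be a double root of \<open>F\<close>.\<close>
    have simple: "\<not> negl (\<lambda>i. poly (pderiv (G (x i))) (y i))"
    proof
      assume neg: "negl (\<lambda>i. poly (pderiv (G (x i))) (y i))"
      obtain e q Q R where QR: "poly_family K q Q" "poly_family K d R"
        "\<And>z. smult (coeff (G z) d ^ e) (F z) = Q z * G z + R z"
        "\<And>m. negl (\<lambda>i. coeff (R (x i)) m)"
        using remainder[OF F(1,2)] by blast
      have "coeff (G (x i)) d ^ e * poly (pderiv (F (x i))) (y i) =
          poly (Q (x i)) (y i) * poly (pderiv (G (x i))) (y i)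
          + poly (pderiv (Q (x i))) (y i) * poly (G (x i)) (y i) + poly (pderiv (R (x i))) (y i)" for i
        using arg_cong[OF QR(3), of "\<lambda>p. poly (pderiv p) (y i)" "x i"]
        by (simp add: pderiv_smult pderiv_mult pderiv_add algebra_simps)
      moreover have "negl (\<lambda>i. poly (Q (x i)) (y i) * poly (pderiv (G (x i))) (y i)
          + poly (pderiv (Q (x i))) (y i) * poly (G (x i)) (y i) + poly (pderiv (R (x i))) (y i))"
        using neg Groot bdd_poly[OF QR(1) xK y] bdd_poly[OF poly_family_pderiv[OF QR(1)] xK y]
          negl_pderiv[of d "\<lambda>i. R (x i)" y] QR(2,4) y
        by (intro negl_add negl_mult_left) (auto simp: poly_family_def)
      ultimately have "negl (\<lambda>i. coeff (G (x i)) d ^ e * poly (pderiv (F (x i))) (y i))" by simp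
      with not_negl_mult[OF not_negl_power[OF lead] F(3)] show False by blast
    qed
    have "\<forall>f\<in>S. \<exists>R. poly_family K d R \<and> (\<forall>m. negl (\<lambda>i. coeff (R (x i)) m)) \<and>
        (\<forall>z. coeff (G z) d \<noteq> 0 \<longrightarrow> poly (G z) (z j) = 0 \<longrightarrow> R z = 0 \<longrightarrow> f z = 0)"
    proof
      fix f assume f: "f \<in> S"
      obtain h H where H: "poly_family K h H" "\<And>z. f z = poly (H z) (z j)"
        using coord_poly_insert[of j K f] less.prems(4)[OF f] K(2) by auto
      have "negl (\<lambda>i. poly (H (x i)) (y i))"
        using less.prems(5)[OF f] by (simp add: H(2) y_def)
      from remainder[OF H(1) this] obtain e Q R where QR: "poly_family K d R"
        "\<And>z. smult (coeff (G z) d ^ e) (H z) = Q z * G z + R z"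
        "\<And>m. negl (\<lambda>i. coeff (R (x i)) m)" by blast
      have "f z = 0" if "coeff (G z) d \<noteq> 0" "poly (G z) (z j) = 0" "R z = 0" for z
        using arg_cong[OF QR(2), of "\<lambda>p. poly p (z j)" z] that by (simp add: H(2))
      with QR(1,3) show "\<exists>R. poly_family K d R \<and> (\<forall>m. negl (\<lambda>i. coeff (R (x i)) m)) \<and>
        (\<forall>z. coeff (G z) d \<noteq> 0 \<longrightarrow> poly (G z) (z j) = 0 \<longrightarrow> R z = 0 \<longrightarrow> f z = 0)" by blast
    qed
    from bchoice[OF this] obtain R where R: "\<And>f. f \<in> S \<Longrightarrow> poly_family K d (R f)"
      "\<And>f m. f \<in> S \<Longrightarrow> negl (\<lambda>i. coeff (R f (x i)) m)"
      "\<And>f z. f \<in> S \<Longrightarrow> coeff (G z) d \<noteq> 0 \<Longrightarrow> poly (G z) (z j) = 0 \<Longrightarrow> R f z = 0 \<Longrightarrow> f z = 0"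
      by blast
    \<comment> \<open>The system in fewer coordinates: all coefficients of the remainders of the
      members of \<open>S\<close>.\<close>
    define T where "T = (\<Union>f\<in>S. (\<lambda>m z. coeff (R f z) m) ` {..<d})"
    have "\<exists>x'. (\<forall>k\<in>K. negl (\<lambda>i. x i k - x' i k)) \<and> (\<forall>f\<in>T. \<forall>\<^sub>F i in U. f (x' i) = 0)"
    proof (rule less.hyps[OF K(4) K(1) xK])
      show "coord_poly K f" if "f \<in> T" for f
        using that R(1) by (auto simp: T_def poly_family_def)
      show "negl (\<lambda>i. f (x i))" if "f \<in> T" for f
        using that R(2) by (auto simp: T_def)
    qed (use less.prems(3) in \<open>auto simp: T_def\<close>)
    then obtain x' where x': "\<And>k. k \<in> K \<Longrightarrow> negl (\<lambda>i. x i k - x' i k)"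
      "\<And>f. f \<in> T \<Longrightarrow> \<forall>\<^sub>F i in U. f (x' i) = 0" by blast
    have x'K: "bdd (\<lambda>i. x' i k)" if "k \<in> K" for k
      using bdd_diff[OF xK[OF that] negl_imp_bdd[OF x'(1)[OF that]]] by simp
    have approx: "negl (\<lambda>i. f (x i) - f (x' i))" if "coord_poly K f" for f
      using that xK x'K x'(1) by (rule negl_diff_coord_poly)
    have approx_poly: "negl (\<lambda>i. poly (P (x i)) (y i) - poly (P (x' i)) (y i))"
      if P: "poly_family K n P" for n P
    proof -
      have "negl (\<lambda>i. poly (P (x i) - P (x' i)) (y i))"
      proof (rule negl_poly[OF _ _ y])
        show "coeff (P (x i) - P (x' i)) m = 0" if "n \<le> m" for i m
          using P that by (simp add: poly_family_def)
        show "negl (\<lambda>i. coeff (P (x i) - P (x' i)) m)" for m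
          using approx[of "\<lambda>z. coeff (P z) m"] P by (simp add: poly_family_def)
      qed
      then show ?thesis by simp
    qed
    \<comment> \<open>Passing from \<open>x\<close> to \<open>x'\<close> alters the value and
      derivative of \<open>G\<close> at \<open>y\<close> only negligibly, so \<open>y\<close>
      remains an approximate simple root.\<close>
    have "\<exists>z. negl (\<lambda>i. z i - y i) \<and> (\<forall>\<^sub>F i in U. poly (G (x' i)) (z i) = 0)"
    proof (rule hensel_negl[OF _ _ y])
      show "bdd (\<lambda>i. coeff (G (x' i)) m)" for m
        using Gf x'K by (intro bdd_coord_poly[where J = K and f = "\<lambda>z. coeff (G z) m"]) (auto simp: poly_family_def)
      show "coeff (G (x' i)) m = 0" if "Suc d \<le> m" for i m
        using Gf that by (simp add: poly_family_def)
      show "negl (\<lambda>i. poly (G (x' i)) (y i))"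
        using negl_diff[OF Groot approx_poly[OF Gf]] by simp
      show "\<not> negl (\<lambda>i. poly (pderiv (G (x' i))) (y i))"
        using simple approx_poly[OF poly_family_pderiv[OF Gf]] by (rule not_negl_cong)
    qed
    then obtain z where z: "negl (\<lambda>i. z i - y i)" "\<forall>\<^sub>F i in U. poly (G (x' i)) (z i) = 0" by blast
    define x'' where "x'' i = (x' i)(j := z i)" for i
    have fam: "P (x'' i) = P (x' i)" if "poly_family K n P" for n P i
      using that K(3) by (intro poly_family_cong[OF that]) (auto simp: x''_def)
    \<comment> \<open>Needed to cancel the power of the leading coefficient introduced by
      pseudo-division.\<close>
    have nz: "\<forall>\<^sub>F i in U. coeff (G (x' i)) d \<noteq> 0"
      using not_negl_cong[OF lead approx[OF g]] by (rule not_negl_imp_nonzero)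
    have "\<forall>\<^sub>F i in U. f (x'' i) = 0" if f: "f \<in> S" for f
    proof -
      have "\<forall>\<^sub>F i in U. \<forall>m\<in>{..<d}. coeff (R f (x' i)) m = 0"
        using f x'(2) by (intro eventually_ball_finite) (auto simp: T_def)
      with nz z(2) show ?thesis
      proof eventually_elim
        case (elim i)
        have "R f (x' i) = 0"
        proof (rule poly_eqI)
          show "coeff (R f (x' i)) m = coeff 0 m" for m
            using elim(3) R(1)[OF f] by (cases "m < d") (simp_all add: poly_family_def)
        qed
        with elim(1,2) show ?case
          using R(3)[OF f, of "x'' i"] fam[OF R(1)[OF f], of i] fam[OF Gf, of i]
          by (simp add: x''_def)
      qed
    qed
    moreover have "negl (\<lambda>i. x i k - x'' i k)" if "k \<in> J" for k
    proof (cases "k = j")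
      case True
      then show ?thesis using z(1) negl_minus[of "\<lambda>i. z i - y i"] by (simp add: x''_def y_def)
    next
      case False
      then show ?thesis using x'(1)[of k] that by (simp add: x''_def K_def)
    qed
    ultimately show ?thesis by blast
  qed
qed

end

subsection \<open>The inequality\<close>

lemma rpow_of_nat: "t \<ge> 0 \<Longrightarrow> rpow t (real m) = t ^ m"
  by (cases "m = 0"; cases "t = 0") (auto simp: rpow_def powr_realpow)

lemma polynomial_function_over_coord_poly:
  fixes scale :: "'k::field \<Rightarrow> 'v::ab_group_add \<Rightarrow> 'v"
  assumes "polynomial_function_over scale f"
  shows "\<exists>g. coord_poly B g \<and> (\<forall>z. f (\<Sum>b\<in>B. scale (z b) b) = g z)"
  using assms
proof induction
  case (linear l)
  interpret Vector_Spaces.linear scale "(*)" l by (rule linear)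
  have "l (\<Sum>b\<in>B. scale (z b) b) = (\<Sum>b\<in>B. z b * l b)" for z
    by (simp add: sum scale)
  moreover have "coord_poly B (\<lambda>z. \<Sum>b\<in>B. z b * l b)"
    by (intro coord_poly_sum coord_poly.mult coord_poly.var coord_poly.const)
  ultimately show ?case by (intro exI[of _ "\<lambda>z. \<Sum>b\<in>B. z b * l b"]) simp
next
  case (const c)
  show ?case by (intro exI[of _ "\<lambda>z. c"]) (simp add: coord_poly.const)
next
  case (add g h)
  then obtain g' h' where "coord_poly B g'" "\<forall>z. g (\<Sum>b\<in>B. scale (z b) b) = g' z"
    "coord_poly B h'" "\<forall>z. h (\<Sum>b\<in>B. scale (z b) b) = h' z" by blast
  then show ?case by (intro exI[of _ "\<lambda>z. g' z + h' z"]) (simp add: coord_poly.add)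
next
  case (mult g h)
  then obtain g' h' where "coord_poly B g'" "\<forall>z. g (\<Sum>b\<in>B. scale (z b) b) = g' z"
    "coord_poly B h'" "\<forall>z. h (\<Sum>b\<in>B. scale (z b) b) = h' z" by blast
  then show ?case by (intro exI[of _ "\<lambda>z. g' z * h' z"]) (simp add: coord_poly.mult)
qed

locale normed_space_over_local_field =
  nonarch_local_field v + finite_dimensional_vector_space scale B + norm: nonarch_norm v scale nrm
  for v :: "'k::local_field \<Rightarrow> real" and scale :: "'k \<Rightarrow> 'v::ab_group_add \<Rightarrow> 'v"
    and B :: "'v set" and nrm :: "'v \<Rightarrow> real"
begin

section \<open>Comparison of the norm with coordinates\<close>

lemma nrm_zero [simp]: "nrm 0 = 0"
  by (simp add: norm.eq_0_iff)

lemma nrm_minus: "nrm (- x) = nrm x"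
  using norm.scale[of "-1" x] by simp

lemma nrm_diff_le: "nrm (x - y) \<le> max (nrm x) (nrm y)"
  using norm.ultrametric[of x "- y"] by (simp add: nrm_minus)

lemma nrm_add_le: "nrm (x + y) \<le> nrm x + nrm y"
  using norm.ultrametric[of x y] norm.nonneg[of x] norm.nonneg[of y] by linarith

lemma nrm_sum_le: "nrm (\<Sum>b\<in>A. scale (z b) b) \<le> (\<Sum>b\<in>A. v (z b) * nrm b)"
proof (induction A rule: infinite_finite_induct)
  case (insert a A)
  then show ?case
    using nrm_add_le[of "scale (z a) a" "\<Sum>b\<in>A. scale (z b) b"] by (simp add: norm.scale)
qed simp_all

lemma coordinates_exist: "\<exists>z. x = (\<Sum>b\<in>B. scale (z b) b)"
proof -
  have "x \<in> span B" by (simp add: span_Basis)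
  then show ?thesis unfolding span_finite[OF finite_Basis] by auto
qed

text \<open>The norm is Lipschitz in the coordinates, homogeneous of degree 1 and, by independence
  of the basis, zero only at 0; so \<open>homogeneous_lower_bound\<close> applies.\<close>

lemma coordinates_le_nrm: "\<exists>C>0. \<forall>z. \<forall>b\<in>B. C * v (z b) \<le> nrm (\<Sum>b\<in>B. scale (z b) b)"
proof -
  define \<phi> where "\<phi> z = nrm (\<Sum>b\<in>B. scale (z b) b)" for z
  have lipschitz: "\<bar>\<phi> z - \<phi> w\<bar> \<le> (\<Sum>b\<in>B. v (z b - w b) * nrm b)" for z w
  proof -
    have diff: "(\<Sum>b\<in>B. scale (z b) b) - (\<Sum>b\<in>B. scale (w b) b) = (\<Sum>b\<in>B. scale (z b - w b) b)"
      by (simp add: scale_left_diff_distrib sum_subtractf)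
    have "\<bar>nrm x - nrm y\<bar> \<le> nrm (x - y)" for x y
      using nrm_add_le[of "x - y" y] nrm_add_le[of "y - x" x] nrm_minus[of "x - y"] by simp
    then have "\<bar>\<phi> z - \<phi> w\<bar> \<le> nrm (\<Sum>b\<in>B. scale (z b - w b) b)"
      unfolding \<phi>_def diff[symmetric] .
    then show ?thesis using nrm_sum_le[of "\<lambda>b. z b - w b" B] by linarith
  qed
  have "continuous_on UNIV \<phi>"
    unfolding continuous_on_def
  proof
    fix w
    let ?h = "\<lambda>z. \<Sum>b\<in>B. v (z b - w b) * nrm b"
    have "continuous_on UNIV ?h" by (intro continuous_intros) auto
    then have "(?h \<longlongrightarrow> ?h w) (at w)" unfolding continuous_on_def by blast
    then have "(?h \<longlongrightarrow> 0) (at w)" by simp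
    then have "((\<lambda>z. \<phi> z - \<phi> w) \<longlongrightarrow> 0) (at w)"
      by (rule Lim_null_comparison[rotated]) (simp add: lipschitz)
    then show "(\<phi> \<longlongrightarrow> \<phi> w) (at w)" by (rule LIM_zero_cancel)
  qed
  then have "\<exists>C>0. \<forall>z. \<forall>b\<in>B. C * v (z b) ^ 1 \<le> \<phi> z"
  proof (rule homogeneous_lower_bound[OF finite_Basis zero_less_one])
    show "\<phi> (\<lambda>b. a * z b) = v a ^ 1 * \<phi> z" for a z
      unfolding \<phi>_def by (simp add: norm.scale flip: scale_scale scale_sum_right)
    show "z b = 0" if "\<phi> z = 0" "b \<in> B" for z b
      using independentD[OF independent_Basis finite_Basis order_refl _ that(2), of z] that(1)
      by (simp add: \<phi>_def norm.eq_0_iff)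
    show "\<phi> (\<lambda>b. if b \<in> B then z b else 0) = \<phi> z" for z
      unfolding \<phi>_def by (intro arg_cong[where f = nrm] sum.cong) auto
  qed (simp add: \<phi>_def norm.nonneg)
  then show ?thesis by (simp add: \<phi>_def)
qed

lemma norm_dist_le: "z \<in> Z \<Longrightarrow> norm_dist nrm x Z \<le> nrm (x - z)"
  unfolding norm_dist_def by (rule cINF_lower) (auto intro: bdd_belowI[of _ 0] norm.nonneg)

lemma norm_dist_nonneg: "Z \<noteq> {} \<Longrightarrow> norm_dist nrm x Z \<ge> 0"
  unfolding norm_dist_def by (rule cINF_greatest) (simp_all add: norm.nonneg)

text \<open>For \<open>nrm x \<ge> 1\<close> the factor 2 keeps the value at most 1/2, the minimum
  keeps it below the distance, and the division by the norm makes the coordinates bounded. An empty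
  \<open>Z\<close> is treated separately because an infimum over it has no meaning.\<close>

definition local_scale :: "'v set \<Rightarrow> 'v \<Rightarrow> real" where
  "local_scale Z x = (if Z = {} then 1 else min 1 (norm_dist nrm x Z)) / (2 * nrm x)"

lemma lojasiewicz_local_scale:
  assumes f: "polynomial_function_over scale f"
  shows "\<exists>m. \<forall>x. nrm x \<ge> 1 \<longrightarrow> local_scale (zero_locus f) x > 0 \<longrightarrow>
    local_scale (zero_locus f) x ^ m \<le> v (f x)"
proof (rule ccontr)
  assume neg: "\<not> ?thesis"
  define Z where "Z = zero_locus f"
  \<comment> \<open>Counterexamples to the exponent \<open>m\<close>. These sets are nonempty and
    decrease with \<open>m\<close>, so they generate a proper filter.\<close>
  define A where "A m = {x. nrm x \<ge> 1 \<and> local_scale Z x > 0 \<and> v (f x) < local_scale Z x ^ m}" for m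
  have A: "A m \<noteq> {}" for m
  proof -
    obtain x where "nrm x \<ge> 1" "local_scale Z x > 0" "\<not> local_scale Z x ^ m \<le> v (f x)"
      using neg unfolding Z_def by blast
    then have "x \<in> A m" by (simp add: A_def)
    then show ?thesis by blast
  qed
  have le_half: "local_scale Z x \<le> 1 / 2" and le_inv: "local_scale Z x \<le> 1 / nrm x"
    if "nrm x \<ge> 1" for x
    using that by (auto simp: local_scale_def field_simps min_def)
  have A_mono: "A n \<subseteq> A m" if "m \<le> n" for m n
  proof
    fix x assume x: "x \<in> A n"
    then have "local_scale Z x ^ n \<le> local_scale Z x ^ m"
      using le_half[of x] that by (intro power_decreasing) (auto simp: A_def)
    with x show "x \<in> A m" by (auto simp: A_def)
  qed
  define F where "F = (INF m. principal (A m))"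
  have ev_F: "eventually P F \<longleftrightarrow> (\<exists>m. \<forall>x\<in>A m. P x)" for P
  proof -
    have "eventually P F \<longleftrightarrow> (\<exists>m\<in>UNIV. eventually P (principal (A m)))"
      unfolding F_def
    proof (rule eventually_INF_base)
      fix m n :: nat
      show "\<exists>k\<in>UNIV. principal (A k) \<le> inf (principal (A m)) (principal (A n))"
        using A_mono[of m "max m n"] A_mono[of n "max m n"] by (intro bexI[of _ "max m n"]) auto
    qed simp
    then show ?thesis by (simp add: eventually_principal)
  qed
  have "F \<noteq> bot" using A ev_F[of "\<lambda>_. False"] by (auto simp: trivial_limit_def)
  then obtain U where U: "ultrafilter U" "U \<le> F" by (rule ex_ultrafilter_le)
  have in_A: "\<forall>\<^sub>F x in U. x \<in> A m" for m
    using U(2) ev_F by (blast intro: filter_leD)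
  \<comment> \<open>The value 1/2 is a default outside \<open>A 0\<close>, a set that belongs to the
    ultrafilter.\<close>
  define \<delta> where "\<delta> x = (if x \<in> A 0 then local_scale Z x else 1 / 2)" for x
  interpret nonarch_scale v U \<delta>
  proof
    show "\<delta> x > 0" "\<delta> x \<le> 1 / 2" for x
      using le_half[of x] by (auto simp: \<delta>_def A_def)
  qed (rule U(1))
  obtain rep where rep: "\<And>x. x = (\<Sum>b\<in>B. scale (rep x b) b)"
    using coordinates_exist by metis
  obtain C where C: "C > 0" "\<And>z b. b \<in> B \<Longrightarrow> C * v (z b) \<le> nrm (\<Sum>b\<in>B. scale (z b) b)"
    using coordinates_le_nrm by blast
  obtain g where g: "coord_poly B g" "\<And>z. f (\<Sum>b\<in>B. scale (z b) b) = g z"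
    using polynomial_function_over_coord_poly[OF f, of B] by blast
  have g_rep: "g (rep x) = f x" for x using g(2)[of "rep x"] rep[of x] by simp
  have "bdd (\<lambda>x. rep x b)" if b: "b \<in> B" for b
  proof -
    obtain k where k: "1 / C < 2 ^ k" using real_arch_pow[of 2 "1 / C"] by auto
    have "\<forall>\<^sub>F x in U. v (rep x b) \<le> (1 / \<delta> x) ^ (k + 1)"
      using in_A[of 0]
    proof eventually_elim
      case (elim x)
      then have x: "nrm x \<ge> 1" "\<delta> x > 0" "\<delta> x \<le> 1 / nrm x" using le_inv[of x] by (auto simp: \<delta>_def A_def)
      have "C * v (rep x b) \<le> nrm x" using C(2)[OF b, of "rep x"] rep[of x] by simp
      then have "v (rep x b) \<le> (1 / C) * nrm x" using C(1) by (simp add: field_simps)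
      also have "\<dots> \<le> (1 / \<delta> x) ^ k * (1 / \<delta> x)"
      proof (rule mult_mono)
        show "1 / C \<le> (1 / \<delta> x) ^ k"
          using k power_mono[OF inverse_scale_ge[of x], of k] by simp
        show "nrm x \<le> 1 / \<delta> x" using x by (simp add: field_simps)
      qed (use x in auto)
      finally show ?case by simp
    qed
    then show ?thesis unfolding bdd_def by blast
  qed
  moreover have "negl (\<lambda>x. g (rep x))"
    unfolding negl_def g_rep
  proof
    fix m
    show "\<forall>\<^sub>F x in U. v (f x) \<le> \<delta> x ^ m"
      using in_A[of m]
    proof eventually_elim
      case (elim x)
      then have "x \<in> A 0" using A_mono[of 0 m] by blast
      with elim show ?case by (simp add: \<delta>_def) (simp add: A_def)
    qed
  qed
  ultimately have "\<exists>x'. (\<forall>b\<in>B. negl (\<lambda>x. rep x b - x' x b)) \<and> (\<forall>h\<in>{g}. \<forall>\<^sub>F x in U. h (x' x) = 0)"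
    using g(1) by (intro ex_lift[OF finite_Basis]) auto
  then obtain x' where x': "\<And>b. b \<in> B \<Longrightarrow> negl (\<lambda>x. rep x b - x' x b)"
    "\<forall>\<^sub>F x in U. g (x' x) = 0" by auto
  define y where "y x = (\<Sum>b\<in>B. scale (x' x b) b)" for x
  define W where "W = (\<Sum>b\<in>B. nrm b)"
  \<comment> \<open>The factor \<open>\<delta> x ^ k\<close> will absorb \<open>W\<close>, and one
    further factor \<open>\<delta> x\<close> remains to be compared with the distance.\<close>
  obtain k where k: "W < 2 ^ k" using real_arch_pow[of 2 W] by auto
  have "\<forall>\<^sub>F x in U. \<forall>b\<in>B. v (rep x b - x' x b) \<le> \<delta> x ^ (k + 1)"
    using x'(1) by (intro eventually_ball_finite finite_Basis ballI neglD)
  then have "\<forall>\<^sub>F x in U. False"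
    using x'(2) in_A[of 0]
  proof eventually_elim
    case (elim x)
    have x: "nrm x \<ge> 1" "local_scale Z x > 0" "\<delta> x = local_scale Z x"
      using elim(3) by (auto simp: \<delta>_def A_def)
    \<comment> \<open>An exact zero, so \<open>Z\<close> is nonempty; it turns out to be nearer to
      \<open>x\<close> than the distance to \<open>Z\<close> allows.\<close>
    have y: "y x \<in> Z" using elim(2) g(2)[of "x' x"] by (simp add: Z_def zero_locus_def y_def)
    have "x - y x = (\<Sum>b\<in>B. scale (rep x b - x' x b) b)"
      by (subst rep[of x]) (simp add: y_def scale_left_diff_distrib sum_subtractf)
    then have "nrm (x - y x) \<le> (\<Sum>b\<in>B. v (rep x b - x' x b) * nrm b)"
      using nrm_sum_le[of "\<lambda>b. rep x b - x' x b" B] by simp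
    also have "\<dots> \<le> (\<Sum>b\<in>B. \<delta> x ^ (k + 1) * nrm b)"
      using elim(1) norm.nonneg by (intro sum_mono mult_right_mono) auto
    also have "\<dots> = \<delta> x ^ (k + 1) * W" by (simp only: W_def sum_distrib_left)
    also have "\<dots> = \<delta> x * (\<delta> x ^ k * W)" by simp
    also have "\<dots> < \<delta> x * 1"
    proof (rule mult_strict_left_mono)
      have "\<delta> x ^ k * W \<le> (1 / 2) ^ k * W"
        using power_mono[OF scale_le[of x], of k] scale_pos[of x] norm.nonneg
        by (intro mult_right_mono) (auto simp: W_def intro: sum_nonneg)
      also have "\<dots> < 1" using k by (simp add: power_divide)
      finally show "\<delta> x ^ k * W < 1" .
    qed (rule scale_pos)
    also have "\<delta> x * 1 \<le> norm_dist nrm x Z"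
    proof -
      have "0 \<le> min 1 (norm_dist nrm x Z)" using y norm_dist_nonneg[of Z x] by auto
      then have "local_scale Z x \<le> min 1 (norm_dist nrm x Z) / 1"
        using y x(1) unfolding local_scale_def by (auto intro!: divide_left_mono simp del: div_by_1)
      then show ?thesis using x(3) by simp
    qed
    also have "\<dots> \<le> nrm (x - y x)" by (rule norm_dist_le[OF y])
    finally show False by simp
  qed
  then show False using U(1) by (simp add: ultrafilter_def eventually_False)
qed

end

theorem theorem4p2:
  fixes v :: "'k::local_field \<Rightarrow> real"
    and scale :: "'k \<Rightarrow> 'v::ab_group_add \<Rightarrow> 'v"
    and nrm :: "'v \<Rightarrow> real"
    and f :: "'v \<Rightarrow> 'k"
  assumes "nonarch_local_field v"
    and "\<exists>B. finite_dimensional_vector_space scale B"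
    and "nonarch_norm v scale nrm"
    and "polynomial_function_over scale f"
  shows "(zero_locus f = {} \<longrightarrow>
           (\<exists>C>0. \<exists>\<beta>\<ge>0. \<forall>x. nrm x \<ge> 1 \<longrightarrow> v (f x) \<ge> C / rpow (nrm x) \<beta>))
       \<and> (zero_locus f \<noteq> {} \<longrightarrow>
           (\<exists>C>0. \<exists>\<alpha>\<ge>0. \<exists>\<beta>\<ge>0. \<forall>x. nrm x \<ge> 1 \<longrightarrow>
             v (f x) \<ge> C * (rpow (norm_dist nrm x (zero_locus f)) \<alpha> / rpow (nrm x) \<beta>)))"
proof -
  obtain B where "finite_dimensional_vector_space scale B" using assms(2) by blast
  then interpret normed_space_over_local_field v scale B nrm
    using assms by (simp add: normed_space_over_local_field_def)
  define Z where "Z = zero_locus f"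
  obtain m where m: "\<And>x. nrm x \<ge> 1 \<Longrightarrow> local_scale Z x > 0 \<Longrightarrow> local_scale Z x ^ m \<le> v (f x)"
    using lojasiewicz_local_scale[OF assms(4)] unfolding Z_def by blast
  show ?thesis
  proof (intro conjI impI)
    assume "zero_locus f = {}"
    \<comment> \<open>With no zeros the scale is \<open>1 / (2 * nrm x)\<close>, whence the constant
      and the exponent.\<close>
    then have "(1 / 2) ^ m / rpow (nrm x) (real m) \<le> v (f x)" if "nrm x \<ge> 1" for x
      using m[OF that] that by (simp add: rpow_of_nat local_scale_def Z_def power_divide power_mult_distrib)
    then show "\<exists>C>0. \<exists>\<beta>\<ge>0. \<forall>x. nrm x \<ge> 1 \<longrightarrow> v (f x) \<ge> C / rpow (nrm x) \<beta>"
      by (intro exI[of _ "(1 / 2) ^ m"] exI[of _ "real m"] conjI) auto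
  next
    assume "zero_locus f \<noteq> {}"
    then obtain z where z: "z \<in> Z" by (auto simp: Z_def)
    \<comment> \<open>Then the distance is at most \<open>M * nrm x\<close>, so its quotient by
      \<open>M * nrm x\<close> is at most 1 as well as at most the distance.\<close>
    define M where "M = max 1 (nrm z)"
    have "(1 / (2 * M)) ^ Suc m * (norm_dist nrm x Z ^ Suc m / nrm x ^ (2 * Suc m)) \<le> v (f x)"
      if x: "nrm x \<ge> 1" for x
    proof -
      let ?d = "norm_dist nrm x Z"
      have d: "?d \<ge> 0" using z by (intro norm_dist_nonneg) auto
      have M: "M \<ge> 1" by (simp add: M_def)
      have "nrm x \<le> M * nrm x" using x M mult_right_mono[of 1 M "nrm x"] by simp
      moreover have "nrm z \<le> M * nrm x"
        using x M mult_left_mono[of 1 "nrm x" M] by (simp add: M_def)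
      ultimately have dM: "?d \<le> M * nrm x"
        using norm_dist_le[OF z, of x] nrm_diff_le[of x z] by linarith
      have "1 \<le> M * nrm x" using M x \<open>nrm x \<le> M * nrm x\<close> by linarith
      then have "?d / (M * nrm x) \<le> min 1 ?d"
        using dM d by (simp add: divide_le_eq mult_left_le) (simp add: mult_le_cancel_left1)
      then have "?d / (M * nrm x) / (2 * nrm x) \<le> local_scale Z x"
        using z x divide_right_mono[of "?d / (M * nrm x)" "min 1 ?d" "2 * nrm x"]
        by (cases "Z = {}") (simp_all add: local_scale_def)
      then have le: "1 / (2 * M) * (?d / nrm x ^ 2) \<le> local_scale Z x"
        by (simp add: power2_eq_square mult_ac)
      have "(1 / (2 * M)) ^ Suc m * (?d ^ Suc m / nrm x ^ (2 * Suc m))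
          = (1 / (2 * M) * (?d / nrm x ^ 2)) ^ Suc m"
        by (simp only: power_mult power_divide power_mult_distrib)
      \<comment> \<open>The exponent is \<open>Suc m\<close> rather than \<open>m\<close> because it
        must be positive: where the scale is 0, its power then vanishes.\<close>
      also have "\<dots> \<le> local_scale Z x ^ Suc m"
        using le d M by (intro power_mono) simp_all
      also have "\<dots> \<le> v (f x)"
      proof (cases "local_scale Z x > 0")
        case True
        have "local_scale Z x \<le> 1"
          using x d z by (auto simp: local_scale_def field_simps min_def)
        then have "local_scale Z x ^ Suc m \<le> local_scale Z x ^ m"
          using True by (intro power_decreasing) auto
        with m[OF x True] show ?thesis by linarith
      next
        case False
        have "local_scale Z x \<ge> 0" using d x by (simp add: local_scale_def)
        with False show ?thesis by (simp add: nonneg)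
      qed
      finally show ?thesis .
    qed
    then have "(1 / (2 * M)) ^ Suc m *
        (rpow (norm_dist nrm x (zero_locus f)) (real (Suc m)) / rpow (nrm x) (real (2 * Suc m))) \<le> v (f x)"
      if "nrm x \<ge> 1" for x
      using that z norm_dist_nonneg[of Z x] unfolding Z_def[symmetric]
      by (subst (1 2) rpow_of_nat) auto
    moreover have "(1 / (2 * M)) ^ Suc m > 0" by (simp add: M_def)
    ultimately show "\<exists>C>0. \<exists>\<alpha>\<ge>0. \<exists>\<beta>\<ge>0. \<forall>x. nrm x \<ge> 1 \<longrightarrow>
        v (f x) \<ge> C * (rpow (norm_dist nrm x (zero_locus f)) \<alpha> / rpow (nrm x) \<beta>)"
      by (meson of_nat_0_le_iff)
  qed
qed

end
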